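(* Let $V$ be a Euclidean vector space and let $A\subset\mathbb{R}[V]$ be a Laplacian algebra. Then $A$ is maximal; that is, every polynomial $f\in\mathbb{R}[V]$ that is constant on each equivalence class of $\sim_A$ belongs to $A$.
   Context: A Euclidean vector space is a finite-dimensional real vector space $V$ with an inner product. $\mathbb{R}[V]$ is the algebra of real polynomial functions on $V$; in an orthonormal coordinate system $x_1,\dots,x_n$ put $r^2=\sum_i x_i^2\in\mathbb{R}[V]$ and $\Delta=\sum_i \partial^2/\partial x_i^2$. A sub-algebra $A\subset\mathbb{R}[V]$ is called Laplacian if $r^2\in A$ and $\Delta f\in A$ for all $f\in A$. For a sub-algebra $A\subset \mathbb{R}[V]$, define the equivalence relation $\sim_A$ on $V$ by $v\sim_A w$ if and only if $f(v)=f(w)$ for all $f\in A$. The sub-algebra $A$ is called maximal if $A$ equals the algebra of all polynomials that are constant on the equivalence classes of $\sim_A$ (equivalently, any strictly larger sub-algebra of $\mathbb{R}[V]$ defines a strictly finer equivalence relation). Algebras contain the constants. *)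

theory Defs
  imports "HOL-Analysis.Analysis"
begin

(* A Euclidean vector space is a type of class real_inner that has a finite
   orthonormal basis B; unlike class euclidean_space this admits dimension 0. *)

definition orthonormal_basis :: "'a::real_inner set \<Rightarrow> bool" where
  "orthonormal_basis B \<longleftrightarrow>
     finite B \<and> pairwise orthogonal B \<and> (\<forall>b\<in>B. norm b = 1) \<and> span B = UNIV"

definition polynomial_subalgebra :: "('a::real_inner \<Rightarrow> real) set \<Rightarrow> bool" where
  "polynomial_subalgebra A \<longleftrightarrow>
     (\<forall>f\<in>A. real_polynomial_function f) \<and>
     (\<forall>c. (\<lambda>x. c) \<in> A) \<and>
     (\<forall>f\<in>A. \<forall>g\<in>A. (\<lambda>x. f x + g x) \<in> A) \<and>
     (\<forall>f\<in>A. \<forall>g\<in>A. (\<lambda>x. f x * g x) \<in> A) \<and>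
     (\<forall>c. \<forall>f\<in>A. (\<lambda>x. c * f x) \<in> A)"

definition partial_deriv :: "'a::real_inner \<Rightarrow> ('a \<Rightarrow> real) \<Rightarrow> 'a \<Rightarrow> real" where
  "partial_deriv b f x = deriv (\<lambda>t. f (x + t *\<^sub>R b)) 0"

definition laplacian :: "'a::real_inner set \<Rightarrow> ('a \<Rightarrow> real) \<Rightarrow> 'a \<Rightarrow> real" where
  "laplacian B f x = (\<Sum>b\<in>B. partial_deriv b (partial_deriv b f) x)"

definition radius_squared :: "'a::real_inner set \<Rightarrow> 'a \<Rightarrow> real" where
  "radius_squared B x = (\<Sum>b\<in>B. (x \<bullet> b)\<^sup>2)"

definition laplacian_algebra :: "'a::real_inner set \<Rightarrow> ('a \<Rightarrow> real) set \<Rightarrow> bool" where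
  "laplacian_algebra B A \<longleftrightarrow>
     polynomial_subalgebra A \<and> radius_squared B \<in> A \<and> (\<forall>f\<in>A. laplacian B f \<in> A)"

definition algebra_rel :: "('a \<Rightarrow> real) set \<Rightarrow> ('a \<times> 'a) set" where
  "algebra_rel A = {(v, w). \<forall>f\<in>A. f v = f w}"

lemma equiv_algebra_rel: "equiv UNIV (algebra_rel A)"
  by (auto simp: algebra_rel_def equiv_def refl_on_def sym_def trans_def)

definition maximal_subalgebra :: "('a::real_inner \<Rightarrow> real) set \<Rightarrow> bool" where
  "maximal_subalgebra A \<longleftrightarrow>
     A = {f. real_polynomial_function f \<and> (\<forall>C \<in> UNIV // algebra_rel A. f constant_on C)}"

end

theory Submission
  imports Defs
begin

text \<open>
  Write \<open>n\<close> for the dimension, \<open>S\<close> for the unit sphere, \<open>r\<^sup>2\<close> for the squared radius and \<open>\<Delta>\<close> for the Laplacian.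
  The proof combines an algebraic and an analytic part.

  Algebra.  The identity \<open>\<Delta>(r\<^sup>2f) = r\<^sup>2\<Delta>f + 2nf + 4Ef\<close> shows that a Laplacian algebra \<open>A\<close> is
  closed under the Euler operator \<open>E\<close>, whose eigenspaces are the homogeneous polynomials; hence
  \<open>A\<close> contains the homogeneous components of its elements
  (\<open>lapalg_homogeneous_component\<close>).  Solving \<open>\<Delta>(r\<^sup>2g) = \<Delta>f\<close> inside \<open>A\<close> then gives the classical
  expansion \<open>f = \<Sum>i. r\<^sup>2\<^sup>i h\<^sub>i\<close> with harmonic \<open>h\<^sub>i\<close>, again with all terms in \<open>A\<close>
  (\<open>lapalg_harmonic_components\<close>).  As \<open>r\<^sup>2 = 1\<close> on \<open>S\<close>, every element of \<open>A\<close> agrees on \<open>S\<close> with a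
  harmonic element of \<open>A\<close> (\<open>lapalg_harmonic_representative\<close>).

  Analysis.  Let \<open>f\<close> be a polynomial that is constant on the classes of \<open>\<sim>\<^sub>A\<close>.  Since \<open>A\<close> is graded,
  \<open>v \<sim>\<^sub>A w\<close> implies \<open>tv \<sim>\<^sub>A tw\<close>, so the homogeneous components of \<open>f\<close> are constant on the classes as
  well and \<open>f\<close> may be taken homogeneous, of degree \<open>d\<close> say.  On \<open>S\<close> it agrees with the harmonic polynomial
  \<open>F = \<Sum>i. h\<^sub>i\<close> built from its expansion.  The Stone-Weierstrass theorem on the compact Hausdorff
  quotient of \<open>S\<close> by \<open>\<sim>\<^sub>A\<close> (\<open>Stone_Weierstrass_quotient\<close>) approximates \<open>F\<close> uniformly on \<open>S\<close> by
  elements of \<open>A\<close>, which may be replaced by harmonic ones.  The decisive point is that the derivatives at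
  \<open>0\<close> of a harmonic polynomial are bounded by its maximum on \<open>S\<close>, with constants that do not depend on its
  degree (\<open>harmonic_iterated_deriv_bound\<close>, from the maximum principle).  Thus the derivatives of \<open>F\<close>
  at \<open>0\<close> of order at most \<open>d\<close> are limits of those of harmonic elements of \<open>A\<close>, and as a
  subspace of a finite-dimensional space is closed, they are attained by one such element \<open>a\<close>.
  These derivatives determine the components of degree at most \<open>d\<close>, so \<open>F\<close>, which has no others,
  is a sum of components of \<open>a\<close> and lies in \<open>A\<close>.  Its components \<open>h\<^sub>i\<close> have distinct degrees
  and therefore lie in \<open>A\<close>, and so does \<open>f = \<Sum>i. r\<^sup>2\<^sup>i h\<^sub>i\<close>.
\<close>

section \<open>Uniform approximation on a quotient\<close>

text \<open>
  The quotient of a compact set by an algebra of functions is realised below inside a power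
  of \<open>\<real>\<close> whose index set may be uncountable.  The three instances make the product topology
  on such a power Hausdorff; the type class hierarchy requires the weaker separation axioms first.
\<close>

lemma open_coordinate_vimage:
  fixes U :: "'b::topological_space set"
  assumes "open U"
  shows "open ((\<lambda>z::'a \<Rightarrow> 'b. z i) -` U)"
  by (rule open_vimage[OF assms continuous_on_product_coordinates])

instance "fun" :: (type, t0_space) t0_space
proof
  fix x y :: "'a \<Rightarrow> 'b"
  assume "x \<noteq> y"
  then obtain i where "x i \<noteq> y i" by blast
  then obtain U where "open U" "\<not> (x i \<in> U \<longleftrightarrow> y i \<in> U)" using separation_t0 by blast
  then show "\<exists>U. open U \<and> \<not> (x \<in> U \<longleftrightarrow> y \<in> U)"
    by (intro exI[of _ "(\<lambda>z. z i) -` U"]) (auto simp: open_coordinate_vimage)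
qed

instance "fun" :: (type, t1_space) t1_space
proof
  fix x y :: "'a \<Rightarrow> 'b"
  assume "x \<noteq> y"
  then obtain i where "x i \<noteq> y i" by blast
  then obtain U where "open U" "x i \<in> U" "y i \<notin> U" using separation_t1 by blast
  then show "\<exists>U. open U \<and> x \<in> U \<and> y \<notin> U"
    by (intro exI[of _ "(\<lambda>z. z i) -` U"]) (auto simp: open_coordinate_vimage)
qed

instance "fun" :: (type, t2_space) t2_space
proof
  fix x y :: "'a \<Rightarrow> 'b"
  assume "x \<noteq> y"
  then obtain i where "x i \<noteq> y i" by blast
  then obtain U V where "open U" "open V" "x i \<in> U" "y i \<in> V" "U \<inter> V = {}"
    using hausdorff by metis
  then show "\<exists>U V. open U \<and> open V \<and> x \<in> U \<and> y \<in> V \<and> U \<inter> V = {}"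
    by (intro exI[of _ "(\<lambda>z. z i) -` U"] exI[of _ "(\<lambda>z. z i) -` V"])
      (auto simp: open_coordinate_vimage)
qed

text \<open>
  Evaluation \<open>\<Phi> v = (g \<mapsto> g v)\<close> identifies the quotient of \<open>S\<close> with the compact Hausdorff
  set \<open>\<Phi> ` S\<close>.  There the coordinate functions, which are the elements of \<open>A\<close>, separate points,
  and \<open>f\<close> descends to a function \<open>F\<close> that is continuous because \<open>\<Phi>\<close> is a closed map.
\<close>

lemma Stone_Weierstrass_quotient:
  fixes S :: "'a::topological_space set" and A :: "('a \<Rightarrow> real) set"
  assumes S: "compact S"
    and cont: "\<And>g. g \<in> A \<Longrightarrow> continuous_on S g"
    and const: "\<And>c. (\<lambda>_. c) \<in> A"
    and add: "\<And>g h. g \<in> A \<Longrightarrow> h \<in> A \<Longrightarrow> (\<lambda>x. g x + h x) \<in> A"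
    and mult: "\<And>g h. g \<in> A \<Longrightarrow> h \<in> A \<Longrightarrow> (\<lambda>x. g x * h x) \<in> A"
    and f: "continuous_on S f"
    and inv: "\<And>v w. v \<in> S \<Longrightarrow> w \<in> S \<Longrightarrow> (\<And>g. g \<in> A \<Longrightarrow> g v = g w) \<Longrightarrow> f v = f w"
    and e: "e > 0"
  obtains a where "a \<in> A" "\<And>x. x \<in> S \<Longrightarrow> \<bar>f x - a x\<bar> < e"
proof -
  define \<Phi> :: "'a \<Rightarrow> ('a \<Rightarrow> real) \<Rightarrow> real" where "\<Phi> v g = (if g \<in> A then g v else 0)" for v g
  define K where "K = \<Phi> ` S"
  have cont\<Phi>: "continuous_on S \<Phi>"
  proof (rule continuous_on_coordinatewise_then_product)
    fix g show "continuous_on S (\<lambda>v. \<Phi> v g)"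
      by (cases "g \<in> A") (auto simp: \<Phi>_def cont)
  qed
  have K: "compact K" unfolding K_def by (rule compact_continuous_image[OF cont\<Phi> S])
  define F where "F = f \<circ> inv_into S \<Phi>"
  have F: "F (\<Phi> v) = f v" if v: "v \<in> S" for v
  proof -
    let ?w = "inv_into S \<Phi> (\<Phi> v)"
    have w: "?w \<in> S" "\<Phi> ?w = \<Phi> v" using v by (auto intro: inv_into_into f_inv_into_f)
    have "f ?w = f v"
    proof (rule inv[OF w(1) v])
      fix g assume "g \<in> A"
      then show "g ?w = g v" using fun_cong[OF w(2), of g] by (simp add: \<Phi>_def)
    qed
    then show ?thesis by (simp add: F_def)
  qed
  have contF: "continuous_on K F"
    unfolding continuous_on_closed_vimage[OF compact_imp_closed[OF K]]
  proof (intro allI impI)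
    fix C :: "real set" assume C: "closed C"
    have "F -` C \<inter> K = \<Phi> ` (f -` C \<inter> S)" unfolding K_def using F by auto
    moreover have "compact (f -` C \<inter> S)"
    proof -
      obtain T where T: "closed T" "T \<inter> S = f -` C \<inter> S"
        using f C by (auto simp: continuous_on_closed_invariant)
      then show ?thesis using closed_Int_compact[OF T(1) S] by simp
    qed
    then have "compact (\<Phi> ` (f -` C \<inter> S))"
      by (intro compact_continuous_image continuous_on_subset[OF cont\<Phi>]) auto
    ultimately show "closed (F -` C \<inter> K)" by (simp add: compact_imp_closed)
  qed
  \<comment> \<open>The functions on the quotient that come from \<open>A\<close>.\<close>
  define R where "R = {G. continuous_on K G \<and> (\<exists>a\<in>A. \<forall>v\<in>S. G (\<Phi> v) = a v)}"
  have "function_ring_on R K"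
  proof
    show "compact K" by (rule K)
    show "continuous_on K G" if "G \<in> R" for G using that by (simp add: R_def)
    show "(\<lambda>x. G x + G' x) \<in> R" if GR: "G \<in> R" "G' \<in> R" for G G'
    proof -
      obtain a a' where "a \<in> A" "a' \<in> A" "\<forall>v\<in>S. G (\<Phi> v) = a v" "\<forall>v\<in>S. G' (\<Phi> v) = a' v"
        using GR by (auto simp: R_def)
      then have "(\<lambda>x. a x + a' x) \<in> A" "\<forall>v\<in>S. G (\<Phi> v) + G' (\<Phi> v) = a v + a' v"
        using add by simp_all
      moreover have "continuous_on K (\<lambda>x. G x + G' x)"
        using GR by (auto simp: R_def intro: continuous_on_add)
      ultimately show ?thesis unfolding R_def by (intro CollectI conjI bexI[of _ "\<lambda>x. a x + a' x"])
    qed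
    show "(\<lambda>x. G x * G' x) \<in> R" if GR: "G \<in> R" "G' \<in> R" for G G'
    proof -
      obtain a a' where "a \<in> A" "a' \<in> A" "\<forall>v\<in>S. G (\<Phi> v) = a v" "\<forall>v\<in>S. G' (\<Phi> v) = a' v"
        using GR by (auto simp: R_def)
      then have "(\<lambda>x. a x * a' x) \<in> A" "\<forall>v\<in>S. G (\<Phi> v) * G' (\<Phi> v) = a v * a' v"
        using mult by simp_all
      moreover have "continuous_on K (\<lambda>x. G x * G' x)"
        using GR by (auto simp: R_def intro: continuous_on_mult)
      ultimately show ?thesis unfolding R_def by (intro CollectI conjI bexI[of _ "\<lambda>x. a x * a' x"])
    qed
    show "(\<lambda>_. c) \<in> R" for c
      using const[of c] unfolding R_def by auto
    show "\<exists>G\<in>R. G x \<noteq> G y" if xy: "x \<in> K" "y \<in> K" "x \<noteq> y" for x y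
    proof -
      obtain g where g: "x g \<noteq> y g" using xy(3) by blast
      have "g \<in> A" using g xy(1,2) by (auto simp: K_def \<Phi>_def split: if_splits)
      moreover have "continuous_on K (\<lambda>z. z g)"
        by (rule continuous_on_subset[OF continuous_on_product_coordinates subset_UNIV])
      moreover have "\<forall>v\<in>S. \<Phi> v g = g v" using \<open>g \<in> A\<close> by (simp add: \<Phi>_def)
      ultimately have "(\<lambda>z. z g) \<in> R" unfolding R_def by (intro CollectI conjI bexI[of _ g])
      with g show ?thesis by (intro bexI[of _ "\<lambda>z. z g"])
    qed
  qed
  from function_ring_on.Stone_Weierstrass_basic[OF this contF e]
  obtain G where G: "G \<in> R" "\<forall>x\<in>K. \<bar>F x - G x\<bar> < e" by blast
  obtain a where a: "a \<in> A" "\<forall>v\<in>S. G (\<Phi> v) = a v" using G(1) by (auto simp: R_def)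
  show ?thesis
  proof (rule that[OF a(1)])
    fix x assume "x \<in> S"
    then show "\<bar>f x - a x\<bar> < e" using G(2) a(2) F[of x] by (auto simp: K_def)
  qed
qed

section \<open>Approximation in finitely many linear functionals\<close>

text \<open>
  Equivalently, the image of \<open>F\<close> under the finitely many functionals is a subspace of a
  finite-dimensional space and hence closed.  The induction removes one functional at a time: if
  \<open>\<phi> i\<close> does not vanish on \<open>F\<close>, subtracting a multiple of some \<open>g\<close> with \<open>\<phi> i g \<noteq> 0\<close> reduces to the
  subspace of \<open>F\<close> on which it vanishes.  \<open>P\<close> is an ambient space on which the functionals are
  linear, as derivatives at a point are on the polynomials.
\<close>

lemma attained_if_approximable:
  fixes \<phi> :: "'i \<Rightarrow> ('a \<Rightarrow> real) \<Rightarrow> real"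
  assumes "finite I" and "(\<lambda>_. 0) \<in> F" and F: "F \<subseteq> P"
    and Pc: "\<And>c g h. g \<in> P \<Longrightarrow> h \<in> P \<Longrightarrow> (\<lambda>x. g x + c * h x) \<in> P"
    and "\<And>c g h. g \<in> F \<Longrightarrow> h \<in> F \<Longrightarrow> (\<lambda>x. g x + c * h x) \<in> F"
    and lin: "\<And>i c g h. i \<in> I \<Longrightarrow> g \<in> P \<Longrightarrow> h \<in> P \<Longrightarrow> \<phi> i (\<lambda>x. g x + c * h x) = \<phi> i g + c * \<phi> i h"
    and "f \<in> P"
    and "\<And>e. e > 0 \<Longrightarrow> \<exists>a\<in>F. \<forall>i\<in>I. \<bar>\<phi> i a - \<phi> i f\<bar> < e"
  shows "\<exists>a\<in>F. \<forall>i\<in>I. \<phi> i a = \<phi> i f"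
  using assms(1,2,3,5-8)
proof (induction I arbitrary: F f rule: finite_induct)
  case empty
  then show ?case by auto
next
  case (insert i I)
  have lin: "\<phi> j (\<lambda>x. g x + c * h x) = \<phi> j g + c * \<phi> j h"
    if "j \<in> insert i I" "g \<in> P" "h \<in> P" for j g h c
    using insert.prems(4) that by blast
  have closed: "(\<lambda>x. g x + c * h x) \<in> F" if "g \<in> F" "h \<in> F" for c g h
    using insert.prems(3) that by blast
  have appr: "\<exists>a\<in>F. \<forall>j\<in>insert i I. \<bar>\<phi> j a - \<phi> j f\<bar> < e" if "e > 0" for e
    using insert.prems(6) that by blast
  show ?case
  proof (cases "\<exists>g\<in>F. \<phi> i g \<noteq> 0")
    case False
    have "\<phi> i f = 0"
    proof (rule ccontr)
      assume "\<phi> i f \<noteq> 0"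
      then obtain a where "a \<in> F" "\<bar>\<phi> i a - \<phi> i f\<bar> < \<bar>\<phi> i f\<bar>"
        using appr[of "\<bar>\<phi> i f\<bar>"] by auto
      then show False using False by auto
    qed
    moreover have "\<exists>a\<in>F. \<forall>j\<in>I. \<phi> j a = \<phi> j f"
    proof (rule insert.IH)
      show "(\<lambda>_. 0) \<in> F" "F \<subseteq> P" "f \<in> P" by (fact insert.prems)+
      show "(\<lambda>x. g x + c * h x) \<in> F" if "g \<in> F" "h \<in> F" for c g h
        using that by (rule closed)
      show "\<phi> j (\<lambda>x. g x + c * h x) = \<phi> j g + c * \<phi> j h"
        if "j \<in> I" "g \<in> P" "h \<in> P" for j c g h using that by (intro lin) auto
      show "\<exists>a\<in>F. \<forall>j\<in>I. \<bar>\<phi> j a - \<phi> j f\<bar> < e" if "e > 0" for e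
        using appr[OF that] by auto
    qed
    ultimately show ?thesis using False by auto
  next
    case True
    then obtain g where g: "g \<in> F" "\<phi> i g \<noteq> 0" by blast
    define p where "p h = (\<lambda>x. h x + (- \<phi> i h / \<phi> i g) * g x)" for h
    have gP: "g \<in> P" using g insert.prems by auto
    have pP: "p h \<in> P" if "h \<in> P" for h unfolding p_def using that gP by (rule Pc)
    have pF: "p h \<in> F" if "h \<in> F" for h unfolding p_def using that g(1) by (rule closed)
    have \<phi>p: "\<phi> j (p h) = \<phi> j h + (- \<phi> i h / \<phi> i g) * \<phi> j g" if "j \<in> insert i I" "h \<in> P" for j h
      unfolding p_def using that gP by (intro lin)
    define F' where "F' = {h \<in> F. \<phi> i h = 0}"
    have "\<exists>a\<in>F'. \<forall>j\<in>I. \<phi> j a = \<phi> j (p f)"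
    proof (rule insert.IH)
      show "(\<lambda>_. 0) \<in> F'"
      proof -
        have "(\<lambda>_. 0) \<in> P" using insert.prems(1,2) by blast
        then have "\<phi> i (\<lambda>_. 0) = 0" using lin[of i "\<lambda>_. 0" "\<lambda>_. 0" 1] by simp
        then show ?thesis using insert.prems(1) by (simp add: F'_def)
      qed
      show "F' \<subseteq> P" using insert.prems(2) by (auto simp: F'_def)
      show "(\<lambda>x. g x + c * h x) \<in> F'" if "g \<in> F'" "h \<in> F'" for c g h
      proof -
        have "g \<in> P" "h \<in> P" using that insert.prems(2) by (auto simp: F'_def)
        then have "\<phi> i (\<lambda>x. g x + c * h x) = 0"
          using lin[of i g h c] that by (simp add: F'_def)
        then show ?thesis using closed that by (simp add: F'_def)
      qed
      show "\<phi> j (\<lambda>x. g x + c * h x) = \<phi> j g + c * \<phi> j h"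
        if "j \<in> I" "g \<in> P" "h \<in> P" for j c g h using that by (intro lin) auto
      show "p f \<in> P" using insert.prems(5) by (rule pP)
      fix e :: real assume e: "e > 0"
      \<comment> \<open>\<open>M\<close> bounds the norm of the projection \<open>p\<close>, so an error \<open>e / (2M)\<close> grows to at most \<open>e / 2\<close>.\<close>
      define M where "M = 1 + (\<Sum>j\<in>I. \<bar>\<phi> j g / \<phi> i g\<bar>)"
      have M: "M \<ge> 1" by (simp add: M_def sum_nonneg)
      obtain a where a: "a \<in> F" "\<And>j. j \<in> insert i I \<Longrightarrow> \<bar>\<phi> j a - \<phi> j f\<bar> < e / (2 * M)"
        using appr[of "e / (2 * M)"] e M by auto
      have aP: "a \<in> P" using a insert.prems(2) by auto
      have "\<bar>\<phi> j (p a) - \<phi> j (p f)\<bar> < e" if j: "j \<in> I" for j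
      proof -
        have le: "\<bar>\<phi> j g / \<phi> i g\<bar> \<le> M - 1"
          unfolding M_def using member_le_sum[OF j, of "\<lambda>j. \<bar>\<phi> j g / \<phi> i g\<bar>"] insert.hyps(1) by auto
        have "\<phi> j (p a) - \<phi> j (p f) = (\<phi> j a - \<phi> j f) - (\<phi> i a - \<phi> i f) * (\<phi> j g / \<phi> i g)"
          using \<phi>p[of j a] \<phi>p[of j f] j aP insert.prems(5) by (simp add: diff_divide_distrib left_diff_distrib)
        then have "\<bar>\<phi> j (p a) - \<phi> j (p f)\<bar>
            \<le> \<bar>\<phi> j a - \<phi> j f\<bar> + \<bar>\<phi> i a - \<phi> i f\<bar> * \<bar>\<phi> j g / \<phi> i g\<bar>"
          by (metis abs_mult abs_triangle_ineq4)
        also have "\<dots> \<le> e / (2 * M) + (e / (2 * M)) * (M - 1)"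
          using a(2)[of i] a(2)[of j] j le M e
          by (intro add_mono mult_mono) (auto intro: less_imp_le)
        also have "\<dots> = e / 2" using M by (simp add: field_simps)
        also have "\<dots> < e" using e by simp
        finally show ?thesis .
      qed
      moreover have "p a \<in> F'"
        using pF[OF a(1)] \<phi>p[of i a] aP g(2) by (simp add: F'_def)
      ultimately show "\<exists>a\<in>F'. \<forall>j\<in>I. \<bar>\<phi> j a - \<phi> j (p f)\<bar> < e" by blast
    qed
    then obtain a where a: "a \<in> F" "\<phi> i a = 0" "\<forall>j\<in>I. \<phi> j a = \<phi> j (p f)" by (auto simp: F'_def)
    let ?b = "\<lambda>x. a x + (\<phi> i f / \<phi> i g) * g x"
    have aP: "a \<in> P" using a insert.prems(2) by auto
    have "\<phi> j ?b = \<phi> j f" if "j \<in> insert i I" for j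
      unfolding lin[OF that aP gP] using a \<phi>p[of j f] insert.prems(5) g(2) that by auto
    moreover have "?b \<in> F" using a(1) g(1) by (rule closed)
    ultimately show ?thesis by blast
  qed
qed

section \<open>Calculus of polynomial functions\<close>

lemma continuous_on_real_polynomial_function:
  "real_polynomial_function f \<Longrightarrow> continuous_on S f"
  by (simp add: continuous_at_imp_continuous_on continuous_real_polymonial_function)

text \<open>
  The directional derivatives are defined by one-variable limits; relating them to the
  Frechet derivative makes them linear in the direction.
\<close>

lemma directional_has_real_derivative:
  assumes "real_polynomial_function f"
  shows "((\<lambda>t. f (x + t *\<^sub>R b)) has_real_derivative frechet_derivative f (at (x + s *\<^sub>R b)) b) (at s)"
proof -
  let ?y = "x + s *\<^sub>R b"
  have f: "(f has_derivative frechet_derivative f (at ?y)) (at ?y)"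
    using assms frechet_derivative_works differentiable_at_real_polynomial_function by blast
  have "((\<lambda>t. x + t *\<^sub>R b) has_derivative (\<lambda>t. t *\<^sub>R b)) (at s)"
    by (auto intro!: derivative_eq_intros)
  from has_derivative_compose[OF this f]
  have "((\<lambda>t. f (x + t *\<^sub>R b)) has_derivative (\<lambda>t. frechet_derivative f (at ?y) (t *\<^sub>R b))) (at s)" .
  moreover have "(\<lambda>t. frechet_derivative f (at ?y) (t *\<^sub>R b)) = (*) (frechet_derivative f (at ?y) b)"
    using linear_cmul[OF has_derivative_linear[OF f]] by (auto simp: mult.commute)
  ultimately show ?thesis by (simp add: has_field_derivative_def)
qed

lemma partial_deriv_eq_frechet:
  assumes "real_polynomial_function f"
  shows "partial_deriv b f x = frechet_derivative f (at x) b"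
  using DERIV_imp_deriv[OF directional_has_real_derivative[OF assms, of x b 0]]
  by (simp add: partial_deriv_def)

lemma has_partial_deriv:
  assumes "real_polynomial_function f"
  shows "((\<lambda>t. f (x + t *\<^sub>R b)) has_real_derivative partial_deriv b f (x + s *\<^sub>R b)) (at s)"
  using directional_has_real_derivative[OF assms] by (simp add: partial_deriv_eq_frechet[OF assms])

lemma has_partial_deriv_0:
  assumes "real_polynomial_function f"
  shows "((\<lambda>t. f (x + t *\<^sub>R b)) has_real_derivative partial_deriv b f x) (at 0)"
  using has_partial_deriv[OF assms, of x b 0] by simp

lemma partial_deriv_const [simp]: "partial_deriv b (\<lambda>x. c) = (\<lambda>x. 0)"
  by (simp add: partial_deriv_def fun_eq_iff)

lemma partial_deriv_linear:
  assumes "bounded_linear f"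
  shows "partial_deriv b f = (\<lambda>x. f b)"
proof
  fix x
  have f: "real_polynomial_function f" using assms by blast
  show "partial_deriv b f x = f b"
    using partial_deriv_eq_frechet[OF f] frechet_derivative_at[OF bounded_linear_imp_has_derivative[OF assms]]
    by metis
qed

lemma partial_deriv_add:
  assumes "real_polynomial_function f" "real_polynomial_function g"
  shows "partial_deriv b (\<lambda>x. f x + g x) = (\<lambda>x. partial_deriv b f x + partial_deriv b g x)"
proof
  fix x
  show "partial_deriv b (\<lambda>x. f x + g x) x = partial_deriv b f x + partial_deriv b g x"
    using DERIV_imp_deriv[OF DERIV_add[OF has_partial_deriv_0[OF assms(1)] has_partial_deriv_0[OF assms(2)]]]
    unfolding partial_deriv_def[of b "\<lambda>x. f x + g x"] by simp
qed

lemma partial_deriv_mult: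
  assumes "real_polynomial_function f" "real_polynomial_function g"
  shows "partial_deriv b (\<lambda>x. f x * g x) = (\<lambda>x. partial_deriv b f x * g x + f x * partial_deriv b g x)"
proof
  fix x
  show "partial_deriv b (\<lambda>x. f x * g x) x = partial_deriv b f x * g x + f x * partial_deriv b g x"
    using DERIV_imp_deriv[OF DERIV_mult[OF has_partial_deriv_0[OF assms(1), of x b] has_partial_deriv_0[OF assms(2), of x b]]]
    unfolding partial_deriv_def[of b "\<lambda>x. f x * g x"] by simp
qed

lemma partial_deriv_cmult:
  assumes "real_polynomial_function f"
  shows "partial_deriv b (\<lambda>x. c * f x) = (\<lambda>x. c * partial_deriv b f x)"
  using partial_deriv_mult[OF real_polynomial_function.intros(2)[of c] assms, of b] by simp

lemma partial_deriv_sum: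
  assumes "finite I" "\<And>i. i \<in> I \<Longrightarrow> real_polynomial_function (f i)"
  shows "partial_deriv b (\<lambda>x. \<Sum>i\<in>I. f i x) = (\<lambda>x. \<Sum>i\<in>I. partial_deriv b (f i) x)"
  using assms
proof (induction I rule: finite_induct)
  case (insert i I)
  then show ?case
    using partial_deriv_add[of "f i" "\<lambda>x. \<Sum>i\<in>I. f i x" b]
      real_polynomial_function_sum[of I "\<lambda>x i. f i x"] by simp
qed simp

lemma real_polynomial_function_partial_deriv [intro]:
  "real_polynomial_function f \<Longrightarrow> real_polynomial_function (partial_deriv b f)"
proof (induction rule: real_polynomial_function.induct)
  case (linear f)
  then show ?case by (simp add: partial_deriv_linear real_polynomial_function.intros(2))
qed (auto simp: partial_deriv_add partial_deriv_mult)

lemma partial_deriv_commute: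
  "real_polynomial_function f \<Longrightarrow> partial_deriv a (partial_deriv b f) = partial_deriv b (partial_deriv a f)"
proof (induction rule: real_polynomial_function.induct)
  case (linear f)
  then show ?case by (simp add: partial_deriv_linear)
next
  case (add f g)
  then show ?case by (simp add: partial_deriv_add real_polynomial_function_partial_deriv)
next
  case (mult f g)
  note [intro] = mult.hyps
  have "partial_deriv a (partial_deriv b (\<lambda>x. f x * g x)) =
    (\<lambda>x. partial_deriv a (partial_deriv b f) x * g x + partial_deriv b f x * partial_deriv a g x
       + (partial_deriv a f x * partial_deriv b g x + f x * partial_deriv a (partial_deriv b g) x))"
    if "real_polynomial_function f" "real_polynomial_function g" for a b
    and f g :: "'a \<Rightarrow> real"
    using that by (simp add: partial_deriv_mult partial_deriv_add
        real_polynomial_function_partial_deriv real_polynomial_function.intros(4))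
  from this[OF mult.hyps(1,2)] show ?case using mult.IH by (simp add: algebra_simps)
qed simp

lemma laplacian_eq: "laplacian B f = (\<lambda>x. \<Sum>b\<in>B. partial_deriv b (partial_deriv b f) x)"
  by (simp add: laplacian_def fun_eq_iff)

definition euler :: "'a::real_inner set \<Rightarrow> ('a \<Rightarrow> real) \<Rightarrow> 'a \<Rightarrow> real" where
  "euler B f x = (\<Sum>b\<in>B. (x \<bullet> b) * partial_deriv b f x)"

definition homogeneous :: "nat \<Rightarrow> ('a::real_inner \<Rightarrow> real) \<Rightarrow> bool" where
  "homogeneous k f \<longleftrightarrow> real_polynomial_function f \<and> (\<forall>t x. f (t *\<^sub>R x) = t ^ k * f x)"

lemma homogeneousD: "homogeneous k f \<Longrightarrow> real_polynomial_function f"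
  "homogeneous k f \<Longrightarrow> f (t *\<^sub>R x) = t ^ k * f x"
  by (auto simp: homogeneous_def)

lemma homogeneous_zero: "homogeneous k (\<lambda>x. 0)"
  by (auto simp: homogeneous_def)

lemma homogeneous_add: "homogeneous k f \<Longrightarrow> homogeneous k g \<Longrightarrow> homogeneous k (\<lambda>x. f x + g x)"
  by (auto simp: homogeneous_def algebra_simps)

lemma homogeneous_cmult: "homogeneous k f \<Longrightarrow> homogeneous k (\<lambda>x. c * f x)"
  by (auto simp: homogeneous_def algebra_simps)

lemma homogeneous_mult: "homogeneous k f \<Longrightarrow> homogeneous l g \<Longrightarrow> homogeneous (k + l) (\<lambda>x. f x * g x)"
  by (auto simp: homogeneous_def algebra_simps power_add)

lemma homogeneous_sum:
  "finite I \<Longrightarrow> (\<And>i. i \<in> I \<Longrightarrow> homogeneous k (f i)) \<Longrightarrow> homogeneous k (\<lambda>x. \<Sum>i\<in>I. f i x)"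
  by (induction I rule: finite_induct) (auto simp: homogeneous_zero intro: homogeneous_add)

lemma homogeneous_0_eq: "homogeneous 0 f \<Longrightarrow> f x = f 0"
  using homogeneousD(2)[of 0 f 0 x] by simp

lemma homogeneous_at_0: "homogeneous k f \<Longrightarrow> k \<noteq> 0 \<Longrightarrow> f 0 = 0"
  using homogeneousD(2)[of k f 0 0] by (simp add: power_0_left)

lemma homogeneous_partial_deriv_0:
  "homogeneous 0 f \<Longrightarrow> partial_deriv b f = (\<lambda>x. 0)"
  using homogeneous_0_eq[of f] partial_deriv_const[of b "f 0"] by (metis ext)

lemma homogeneous_partial_deriv:
  assumes f: "homogeneous (Suc k) f"
  shows "homogeneous k (partial_deriv b f)"
  unfolding homogeneous_def
proof (intro conjI allI)
  note pf = homogeneousD(1)[OF f]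
  show pd: "real_polynomial_function (partial_deriv b f)" using pf by blast
  have *: "t * partial_deriv b f (t *\<^sub>R x) = t * (t ^ k * partial_deriv b f x)" for t x
  proof -
    have "((\<lambda>s. t ^ Suc k * f (x + s *\<^sub>R b)) has_real_derivative t ^ Suc k * partial_deriv b f x) (at 0)"
      by (rule DERIV_cmult[OF has_partial_deriv_0[OF pf]])
    moreover have "((\<lambda>s. f (t *\<^sub>R x + (t * s) *\<^sub>R b)) has_real_derivative
        partial_deriv b f (t *\<^sub>R x) * t) (at 0)"
      by (rule DERIV_chain'[where f = "\<lambda>s. t * s" and g = "\<lambda>s. f (t *\<^sub>R x + s *\<^sub>R b)"])
        (auto intro!: derivative_eq_intros simp: has_partial_deriv_0[OF pf])
    moreover have "(\<lambda>s. f (t *\<^sub>R x + (t * s) *\<^sub>R b)) = (\<lambda>s. t ^ Suc k * f (x + s *\<^sub>R b))"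
      unfolding homogeneousD(2)[OF f, symmetric] by (simp add: scaleR_add_right)
    ultimately show ?thesis using DERIV_unique by (fastforce simp: mult.commute)
  qed
  fix t x
  show "partial_deriv b f (t *\<^sub>R x) = t ^ k * partial_deriv b f x"
  proof (cases "t = 0")
    case False
    then show ?thesis using *[of t x] by simp
  next
    case True
    \<comment> \<open>At \<open>t = 0\<close> the factor \<open>t\<close> cannot be cancelled; both sides are continuous in \<open>t\<close>.\<close>
    have c: "continuous_on UNIV (\<lambda>t. partial_deriv b f (t *\<^sub>R x) - t ^ k * partial_deriv b f x)"
      by (intro continuous_intros continuous_on_compose2[OF continuous_on_real_polynomial_function[OF pd, of UNIV]]) auto
    let ?g = "\<lambda>t. partial_deriv b f (t *\<^sub>R x) - t ^ k * partial_deriv b f x"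
    have "?g \<midarrow>0\<rightarrow> ?g 0"
    proof (rule isContD)
      show "isCont ?g 0" using c continuous_on_eq_continuous_at[OF open_UNIV, of ?g] by blast
    qed
    moreover have "?g \<midarrow>0\<rightarrow> 0"
    proof (rule Lim_transform_eventually[OF tendsto_const])
      show "\<forall>\<^sub>F t in at 0. 0 = ?g t" using * by (auto simp: eventually_at intro!: exI[of _ 1])
    qed
    ultimately have "?g 0 = 0" by (rule LIM_unique)
    then show ?thesis using True by simp
  qed
qed

text \<open>
  Quantifying over all upper limits \<open>N \<ge> m\<close> forces \<open>p k = 0\<close> for \<open>k > m\<close>, so that two
  expansions can be compared over a common range of summation.
\<close>

definition homogeneous_expansion :: "('a::real_inner \<Rightarrow> real) \<Rightarrow> nat \<Rightarrow> (nat \<Rightarrow> 'a \<Rightarrow> real) \<Rightarrow> bool" where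
  "homogeneous_expansion f m p \<longleftrightarrow>
     (\<forall>k. homogeneous k (p k)) \<and> (\<forall>N\<ge>m. f = (\<lambda>x. \<Sum>k\<le>N. p k x))"

lemma homogeneous_expansionD:
  assumes "homogeneous_expansion f m p"
  shows "homogeneous k (p k)" and "m \<le> N \<Longrightarrow> f = (\<lambda>x. \<Sum>k\<le>N. p k x)"
  using assms unfolding homogeneous_expansion_def by blast+

lemma homogeneous_expansion_homogeneous:
  assumes "homogeneous k f"
  shows "homogeneous_expansion f k (\<lambda>j. if j = k then f else (\<lambda>x. 0))"
proof -
  have "f x = (\<Sum>j\<le>N. (if j = k then f else (\<lambda>x. 0)) x)" if "N \<ge> k" for N x
  proof -
    have "(\<Sum>j\<le>N. (if j = k then f else (\<lambda>x. 0)) x) = (\<Sum>j\<le>N. if j = k then f x else 0)"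
      by (rule sum.cong) auto
    then show ?thesis using that by simp
  qed
  then show ?thesis using assms by (auto simp: homogeneous_expansion_def homogeneous_zero)
qed

lemma homogeneous_expansion_add:
  assumes "homogeneous_expansion f m p" "homogeneous_expansion g n q"
  shows "homogeneous_expansion (\<lambda>x. f x + g x) (max m n) (\<lambda>k x. p k x + q k x)"
  unfolding homogeneous_expansion_def
proof (intro conjI allI impI)
  show "homogeneous k (\<lambda>x. p k x + q k x)" for k
    using assms by (auto simp: homogeneous_expansion_def intro: homogeneous_add)
  fix N assume "N \<ge> max m n"
  then have "f = (\<lambda>x. \<Sum>k\<le>N. p k x)" "g = (\<lambda>x. \<Sum>k\<le>N. q k x)"
    using assms unfolding homogeneous_expansion_def by (metis max.boundedE)+
  then show "(\<lambda>x. f x + g x) = (\<lambda>x. \<Sum>k\<le>N. p k x + q k x)"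
    by (simp add: sum.distrib)
qed

lemma homogeneous_expansion_mono:
  "homogeneous_expansion f m p \<Longrightarrow> m \<le> n \<Longrightarrow> homogeneous_expansion f n p"
  unfolding homogeneous_expansion_def by (meson le_trans)

lemma homogeneous_expansion_sum:
  assumes "finite I" "\<And>i. i \<in> I \<Longrightarrow> \<exists>p. homogeneous_expansion (f i) m p"
  shows "\<exists>p. homogeneous_expansion (\<lambda>x. \<Sum>i\<in>I. f i x) m p"
  using assms
proof (induction I rule: finite_induct)
  case empty
  have "homogeneous_expansion (\<lambda>x. 0) m (\<lambda>j. if j = 0 then \<lambda>x. 0 else (\<lambda>x. 0))"
    using homogeneous_expansion_homogeneous[OF homogeneous_zero[of 0]]
    by (rule homogeneous_expansion_mono) simp
  then show ?case by auto
next
  case (insert i I)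
  then obtain p q where
    "homogeneous_expansion (f i) m p" "homogeneous_expansion (\<lambda>x. \<Sum>i\<in>I. f i x) m q"
    by fastforce
  from homogeneous_expansion_add[OF this] show ?case using insert.hyps by auto
qed

lemma ex_homogeneous_expansion:
  "real_polynomial_function f \<Longrightarrow> \<exists>m p. homogeneous_expansion f m p"
proof (induction rule: real_polynomial_function.induct)
  case (linear f)
  have "homogeneous 1 f"
    using linear linear_cmul[OF bounded_linear.linear[OF linear]] by (auto simp: homogeneous_def)
  then show ?case using homogeneous_expansion_homogeneous by blast
next
  case (const c)
  have "homogeneous 0 (\<lambda>x. c)" by (auto simp: homogeneous_def)
  then show ?case using homogeneous_expansion_homogeneous by blast
next
  case (add f g)
  then show ?case using homogeneous_expansion_add by blast
next
  case (mult f g)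
  then obtain m p n q where mp: "homogeneous_expansion f m p" and nq: "homogeneous_expansion g n q"
    by blast
  have f: "f = (\<lambda>x. \<Sum>k\<le>m. p k x)" and g: "g = (\<lambda>x. \<Sum>k\<le>n. q k x)"
    using mp nq unfolding homogeneous_expansion_def by blast+
  have "(\<lambda>x. f x * g x) = (\<lambda>x. \<Sum>i\<le>m. \<Sum>j\<le>n. p i x * q j x)"
    unfolding f g by (simp add: sum_product)
  moreover have "\<exists>r. homogeneous_expansion (\<lambda>x. p i x * q j x) (m + n) r"
    if "i \<le> m" "j \<le> n" for i j
  proof -
    have "homogeneous i (p i)" "homogeneous j (q j)"
      using mp nq by (auto simp: homogeneous_expansion_def)
    from homogeneous_expansion_homogeneous[OF homogeneous_mult[OF this]]
    show ?thesis using that by (blast intro: homogeneous_expansion_mono add_mono)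
  qed
  then have "\<exists>r. homogeneous_expansion (\<lambda>x. \<Sum>i\<le>m. \<Sum>j\<le>n. p i x * q j x) (m + n) r"
    by (intro homogeneous_expansion_sum) auto
  ultimately show ?case by auto
qed

primrec iterated_deriv :: "'a::real_inner list \<Rightarrow> ('a \<Rightarrow> real) \<Rightarrow> 'a \<Rightarrow> real" where
  "iterated_deriv [] f = f"
| "iterated_deriv (b # I) f = iterated_deriv I (partial_deriv b f)"

lemma iterated_deriv_linear:
  assumes "real_polynomial_function f" "real_polynomial_function g"
  shows "iterated_deriv I (\<lambda>x. f x + c * g x) = (\<lambda>x. iterated_deriv I f x + c * iterated_deriv I g x)"
  using assms
proof (induction I arbitrary: f g)
  case (Cons b I)
  have "real_polynomial_function (\<lambda>x. c * g x)"
    using Cons.prems by (intro real_polynomial_function.intros(4) real_polynomial_function.intros(2))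
  then have "partial_deriv b (\<lambda>x. f x + c * g x) = (\<lambda>x. partial_deriv b f x + c * partial_deriv b g x)"
    using Cons.prems by (simp add: partial_deriv_add partial_deriv_cmult)
  then show ?case using Cons.IH Cons.prems by (simp add: real_polynomial_function_partial_deriv)
qed simp

lemma iterated_deriv_zero: "iterated_deriv I (\<lambda>x. 0) = (\<lambda>x. 0)"
  by (induction I) auto

lemma iterated_deriv_sum:
  assumes "finite K" "\<And>k. k \<in> K \<Longrightarrow> real_polynomial_function (p k)"
  shows "iterated_deriv I (\<lambda>x. \<Sum>k\<in>K. p k x) = (\<lambda>x. \<Sum>k\<in>K. iterated_deriv I (p k) x)"
  using assms
proof (induction K rule: finite_induct)
  case empty
  then show ?case by (simp add: iterated_deriv_zero)
next
  case (insert k K)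
  have "real_polynomial_function (\<lambda>x. \<Sum>k\<in>K. p k x)"
    using insert by (intro real_polynomial_function_sum) auto
  then show ?case using iterated_deriv_linear[of "p k" "\<lambda>x. \<Sum>k\<in>K. p k x" I 1] insert by simp
qed

text \<open>
  Differentiating \<open>length I\<close> times leaves a form of positive degree, which vanishes at \<open>0\<close>, or
  has already killed the polynomial.
\<close>

lemma iterated_deriv_homogeneous_0:
  "homogeneous k p \<Longrightarrow> length I \<noteq> k \<Longrightarrow> iterated_deriv I p 0 = 0"
proof (induction I arbitrary: k p)
  case Nil
  then show ?case by (simp add: homogeneous_at_0)
next
  case (Cons b I)
  show ?case
  proof (cases k)
    case 0
    then show ?thesis
      using Cons.prems by (simp add: homogeneous_partial_deriv_0 iterated_deriv_zero)
  next
    case (Suc j)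
    then show ?thesis using Cons.IH[OF homogeneous_partial_deriv, of j p b] Cons.prems by simp
  qed
qed

section \<open>Laplacian and Euler operator in an orthonormal frame\<close>

lemma laplacian_add:
  assumes "real_polynomial_function f" "real_polynomial_function g"
  shows "laplacian B (\<lambda>x. f x + g x) = (\<lambda>x. laplacian B f x + laplacian B g x)"
  using assms by (simp add: laplacian_eq partial_deriv_add real_polynomial_function_partial_deriv sum.distrib)

lemma laplacian_cmult:
  assumes "real_polynomial_function f"
  shows "laplacian B (\<lambda>x. c * f x) = (\<lambda>x. c * laplacian B f x)"
  using assms
  by (simp add: laplacian_eq partial_deriv_cmult real_polynomial_function_partial_deriv sum_distrib_left)

lemma laplacian_sum:
  assumes "finite I" "\<And>i. i \<in> I \<Longrightarrow> real_polynomial_function (f i)"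
  shows "laplacian B (\<lambda>x. \<Sum>i\<in>I. f i x) = (\<lambda>x. \<Sum>i\<in>I. laplacian B (f i) x)"
  using assms
  by (simp add: laplacian_eq partial_deriv_sum real_polynomial_function_partial_deriv) (subst sum.swap, simp)

lemma laplacian_mult:
  assumes f: "real_polynomial_function f" and g: "real_polynomial_function g"
  shows "laplacian B (\<lambda>x. f x * g x) = (\<lambda>x. f x * laplacian B g x + g x * laplacian B f x
           + 2 * (\<Sum>b\<in>B. partial_deriv b f x * partial_deriv b g x))"
proof -
  have "partial_deriv b (partial_deriv b (\<lambda>x. f x * g x)) =
    (\<lambda>x. f x * partial_deriv b (partial_deriv b g) x + g x * partial_deriv b (partial_deriv b f) x
       + 2 * (partial_deriv b f x * partial_deriv b g x))" for b
    using assms by (simp add: partial_deriv_mult partial_deriv_add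
        real_polynomial_function_partial_deriv real_polynomial_function.intros(4) algebra_simps)
  then show ?thesis
    by (simp add: laplacian_eq sum.distrib sum_distrib_left)
qed

lemma real_polynomial_function_laplacian [intro]:
  "finite B \<Longrightarrow> real_polynomial_function f \<Longrightarrow> real_polynomial_function (laplacian B f)"
  unfolding laplacian_eq
  by (rule real_polynomial_function_sum) auto

lemma partial_deriv_laplacian:
  assumes "finite B" "real_polynomial_function f"
  shows "laplacian B (partial_deriv b f) = partial_deriv b (laplacian B f)"
proof -
  have "partial_deriv c (partial_deriv c (partial_deriv b f)) = partial_deriv b (partial_deriv c (partial_deriv c f))" for c
    using partial_deriv_commute[OF assms(2), of c b]
      partial_deriv_commute[OF real_polynomial_function_partial_deriv[OF assms(2)], of c b c] by simp
  then show ?thesis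
    using assms by (simp add: laplacian_eq partial_deriv_sum real_polynomial_function_partial_deriv)
qed

lemma homogeneous_laplacian:
  assumes "finite B" "homogeneous d f"
  shows "homogeneous (d - 2) (laplacian B f)"
proof -
  have "homogeneous (d - 2) (partial_deriv b (partial_deriv b f))" for b
  proof (cases d)
    case 0
    then show ?thesis
      using assms(2) by (simp add: homogeneous_partial_deriv_0 homogeneous_zero)
  next
    case (Suc k)
    then have *: "homogeneous k (partial_deriv b f)"
      using assms(2) homogeneous_partial_deriv by blast
    show ?thesis
    proof (cases k)
      case 0
      then show ?thesis using * by (simp add: homogeneous_partial_deriv_0 homogeneous_zero)
    next
      case (Suc j)
      then show ?thesis using * \<open>d = Suc k\<close> homogeneous_partial_deriv by auto
    qed
  qed
  then show ?thesis unfolding laplacian_eq using assms(1) by (intro homogeneous_sum)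
qed

lemma laplacian_homogeneous_lt_2:
  assumes "homogeneous d f" "d < 2"
  shows "laplacian B f = (\<lambda>x. 0)"
proof -
  have "homogeneous 0 f \<or> homogeneous (Suc 0) f"
    using assms by (cases d) (auto simp: less_Suc_eq numeral_2_eq_2)
  then have "partial_deriv b (partial_deriv b f) = (\<lambda>x. 0)" for b
    by (auto simp: homogeneous_partial_deriv_0 dest: homogeneous_partial_deriv[of _ _ b])
  then show ?thesis by (simp add: laplacian_eq)
qed

definition harmonic :: "'a::real_inner set \<Rightarrow> ('a \<Rightarrow> real) \<Rightarrow> bool" where
  "harmonic B h \<longleftrightarrow> real_polynomial_function h \<and> laplacian B h = (\<lambda>x. 0)"

lemma harmonic_zero: "harmonic B (\<lambda>x. 0)"
  using laplacian_cmult[of "\<lambda>x. 0" B 0] by (auto simp: harmonic_def)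

lemma harmonic_add: "harmonic B f \<Longrightarrow> harmonic B g \<Longrightarrow> harmonic B (\<lambda>x. f x + g x)"
  by (auto simp: harmonic_def laplacian_add)

lemma harmonic_cmult: "harmonic B f \<Longrightarrow> harmonic B (\<lambda>x. c * f x)"
  by (auto simp: harmonic_def laplacian_cmult)

lemma harmonic_sum:
  "finite I \<Longrightarrow> (\<And>i. i \<in> I \<Longrightarrow> harmonic B (f i)) \<Longrightarrow> harmonic B (\<lambda>x. \<Sum>i\<in>I. f i x)"
  by (induction I rule: finite_induct) (auto simp: harmonic_zero intro: harmonic_add)

lemma harmonic_partial_deriv: "finite B \<Longrightarrow> harmonic B h \<Longrightarrow> harmonic B (partial_deriv b h)"
  by (auto simp: harmonic_def partial_deriv_laplacian)

context
  fixes B :: "'a::real_inner set"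
  assumes onb: "orthonormal_basis B"
begin

lemma finite_frame: "finite B" using onb by (simp add: orthonormal_basis_def)

lemma frame_expansion: "(\<Sum>b\<in>B. (x \<bullet> b) *\<^sub>R b) = x"
  by (rule orthonormal_basis_expand) (use onb in \<open>auto simp: orthonormal_basis_def\<close>)

lemma radius_squared_eq: "radius_squared B = (\<lambda>x. x \<bullet> x)"
proof
  fix x
  have "radius_squared B x = x \<bullet> (\<Sum>b\<in>B. (x \<bullet> b) *\<^sub>R b)"
    by (simp add: radius_squared_def inner_sum_right power2_eq_square)
  then show "radius_squared B x = x \<bullet> x" by (simp add: frame_expansion)
qed

lemma real_polynomial_function_radius_squared: "real_polynomial_function (radius_squared B)"
  unfolding radius_squared_def[abs_def] using finite_frame
  by (intro real_polynomial_function_sum real_polynomial_function_power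
      real_polynomial_function.intros(1) bounded_linear_inner_left)

lemma homogeneous_radius_squared: "homogeneous 2 (radius_squared B)"
  using real_polynomial_function_radius_squared
  by (auto simp: homogeneous_def radius_squared_eq power2_eq_square)

lemma homogeneous_radius_squared_power: "homogeneous (2 * k) (\<lambda>x. radius_squared B x ^ k)"
  using homogeneous_radius_squared by (auto simp: homogeneous_def power_mult_distrib power_mult)

lemma partial_deriv_inner: "partial_deriv b (\<lambda>x. x \<bullet> c) = (\<lambda>x. b \<bullet> c)"
  by (rule partial_deriv_linear[OF bounded_linear_inner_left])

lemma partial_deriv_radius_squared: "partial_deriv b (radius_squared B) = (\<lambda>x. 2 * (x \<bullet> b))"
proof
  fix x
  have "((\<lambda>t. radius_squared B (x + t *\<^sub>R b)) has_real_derivative 2 * (x \<bullet> b)) (at 0)"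
    unfolding radius_squared_eq has_field_derivative_def
    by (auto intro!: derivative_eq_intros simp: inner_commute fun_eq_iff)
  then show "partial_deriv b (radius_squared B) x = 2 * (x \<bullet> b)"
    unfolding partial_deriv_def by (rule DERIV_imp_deriv)
qed

lemma laplacian_radius_squared: "laplacian B (radius_squared B) = (\<lambda>x. 2 * real (card B))"
proof -
  have "b \<bullet> b = 1" if "b \<in> B" for b
    using onb that by (auto simp: orthonormal_basis_def norm_eq_1)
  then show ?thesis
    by (simp add: laplacian_eq partial_deriv_radius_squared partial_deriv_inner fun_eq_iff
        partial_deriv_cmult real_polynomial_function.intros(1) bounded_linear_inner_left)
qed

lemma directional_derivative_expansion:
  assumes "real_polynomial_function f"
  shows "partial_deriv v f x = (\<Sum>b\<in>B. (v \<bullet> b) * partial_deriv b f x)"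
proof -
  have lin: "linear (frechet_derivative f (at x))"
    using assms frechet_derivative_works has_derivative_linear
      differentiable_at_real_polynomial_function by blast
  have "frechet_derivative f (at x) v = frechet_derivative f (at x) (\<Sum>b\<in>B. (v \<bullet> b) *\<^sub>R b)"
    by (simp add: frame_expansion)
  also have "\<dots> = (\<Sum>b\<in>B. (v \<bullet> b) * frechet_derivative f (at x) b)"
    by (simp add: linear_sum[OF lin] linear_cmul[OF lin])
  finally show ?thesis by (simp add: partial_deriv_eq_frechet[OF assms])
qed

lemma euler_homogeneous:
  assumes "homogeneous k f"
  shows "euler B f = (\<lambda>x. real k * f x)"
proof
  fix x
  have "(\<lambda>t. f (x + t *\<^sub>R x)) = (\<lambda>t. (1 + t) ^ k * f x)"
    using homogeneousD(2)[OF assms, of "1 + _" x] by (auto simp: scaleR_left_distrib)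
  moreover have "((\<lambda>t. (1 + t) ^ k * f x) has_real_derivative real k * f x) (at 0)"
    by (auto intro!: derivative_eq_intros)
  ultimately have "partial_deriv x f x = real k * f x"
    by (simp add: partial_deriv_def DERIV_imp_deriv)
  then show "euler B f x = real k * f x"
    by (simp only: euler_def directional_derivative_expansion[OF homogeneousD(1)[OF assms], of x x])
qed

text \<open>
  This commutation relation between \<open>\<Delta>\<close> and multiplication by \<open>r\<^sup>2\<close> is what ties the two
  defining closure properties of a Laplacian algebra to the grading by degree.
\<close>

lemma laplacian_radius_squared_mult:
  assumes "real_polynomial_function f"
  shows "laplacian B (\<lambda>x. radius_squared B x * f x) =
     (\<lambda>x. radius_squared B x * laplacian B f x + 2 * real (card B) * f x + 4 * euler B f x)"
  unfolding laplacian_mult[OF real_polynomial_function_radius_squared assms]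
    laplacian_radius_squared partial_deriv_radius_squared euler_def
  by (simp add: sum_distrib_left algebra_simps)

text \<open>
  Up to a factor, \<open>\<Delta>\<close> undoes multiplication by \<open>r\<^sup>2\<close> on \<open>r\<^sup>2\<^sup>i h\<close>; the factor is positive in
  positive dimension, so \<open>f \<mapsto> \<Delta>(r\<^sup>2f)\<close> can be inverted on sums of such terms.
\<close>

lemma laplacian_radius_squared_power_mult:
  assumes h: "harmonic B h" "homogeneous l h"
  shows "laplacian B (\<lambda>x. radius_squared B x ^ Suc i * h x) =
    (\<lambda>x. 2 * (real i + 1) * (2 * real i + 2 * real l + real (card B)) * (radius_squared B x ^ i * h x))"
proof (induction i)
  case 0
  have "real_polynomial_function h" using h by (simp add: harmonic_def)
  from laplacian_radius_squared_mult[OF this] show ?case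
    using h by (simp add: harmonic_def euler_homogeneous[OF h(2)] algebra_simps)
next
  case (Suc i)
  let ?u = "\<lambda>x. radius_squared B x ^ Suc i * h x"
  have hu: "homogeneous (2 * Suc i + l) ?u"
    by (rule homogeneous_mult[OF homogeneous_radius_squared_power h(2)])
  let ?R = "radius_squared B" and ?n = "real (card B)"
  have "laplacian B (\<lambda>x. ?R x ^ Suc (Suc i) * h x) = laplacian B (\<lambda>x. ?R x * ?u x)"
    by (simp add: mult.assoc)
  also have "\<dots> = (\<lambda>x. ?R x * laplacian B ?u x + 2 * ?n * ?u x + 4 * euler B ?u x)"
    by (rule laplacian_radius_squared_mult[OF homogeneousD(1)[OF hu]])
  also have "\<dots> = (\<lambda>x. (2 * (real i + 1) * (2 * real i + 2 * real l + ?n)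
      + 2 * ?n + 4 * real (2 * Suc i + l)) * ?u x)"
  proof -
    have aux: "r * (c * (q * y)) + 2 * n * (r * q * y) + 4 * (k * (r * q * y)) = (c + 2 * n + 4 * k) * (r * q * y)"
      for r c q y n k :: real by (simp add: algebra_simps)
    show ?thesis unfolding Suc.IH euler_homogeneous[OF hu] unfolding power_Suc by (simp only: aux)
  qed
  also have "2 * (real i + 1) * (2 * real i + 2 * real l + ?n) + 2 * ?n + 4 * real (2 * Suc i + l)
      = 2 * (real (Suc i) + 1) * (2 * real (Suc i) + 2 * real l + ?n)"
    by (simp add: algebra_simps)
  finally show ?case .
qed

end

section \<open>Laplacian algebras: grading and harmonic components\<close>

context
  fixes B :: "'a::real_inner set" and Q :: "('a \<Rightarrow> real) set"
  assumes lapQ: "laplacian_algebra B Q"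
begin

lemma lapalg_polynomial: "f \<in> Q \<Longrightarrow> real_polynomial_function f"
  using lapQ by (auto simp: laplacian_algebra_def polynomial_subalgebra_def)

lemma lapalg_const: "(\<lambda>x. c) \<in> Q"
  using lapQ by (auto simp: laplacian_algebra_def polynomial_subalgebra_def)

lemma lapalg_add: "f \<in> Q \<Longrightarrow> g \<in> Q \<Longrightarrow> (\<lambda>x. f x + g x) \<in> Q"
  using lapQ by (auto simp: laplacian_algebra_def polynomial_subalgebra_def)

lemma lapalg_mult: "f \<in> Q \<Longrightarrow> g \<in> Q \<Longrightarrow> (\<lambda>x. f x * g x) \<in> Q"
  using lapQ by (auto simp: laplacian_algebra_def polynomial_subalgebra_def)

lemma lapalg_cmult: "f \<in> Q \<Longrightarrow> (\<lambda>x. c * f x) \<in> Q"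
  using lapQ by (auto simp: laplacian_algebra_def polynomial_subalgebra_def)

lemma lapalg_diff: "f \<in> Q \<Longrightarrow> g \<in> Q \<Longrightarrow> (\<lambda>x. f x - g x) \<in> Q"
  using lapalg_add[OF _ lapalg_cmult[of g "- 1"], of f] by simp

lemma lapalg_sum: "finite I \<Longrightarrow> (\<And>i. i \<in> I \<Longrightarrow> f i \<in> Q) \<Longrightarrow> (\<lambda>x. \<Sum>i\<in>I. f i x) \<in> Q"
  by (induction I rule: finite_induct) (auto simp: lapalg_const intro: lapalg_add)

lemma lapalg_power: "f \<in> Q \<Longrightarrow> (\<lambda>x. f x ^ i) \<in> Q"
  by (induction i) (auto simp: lapalg_const intro: lapalg_mult)

lemma lapalg_radius_squared: "radius_squared B \<in> Q"
  using lapQ by (auto simp: laplacian_algebra_def)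

lemma lapalg_laplacian: "f \<in> Q \<Longrightarrow> laplacian B f \<in> Q"
  using lapQ by (auto simp: laplacian_algebra_def)

end

context
  fixes B :: "'a::real_inner set"
  assumes onb: "orthonormal_basis B"
begin

lemma euler_sum_homogeneous:
  assumes "finite I" "\<And>i. i \<in> I \<Longrightarrow> homogeneous (deg i) (p i)"
  shows "euler B (\<lambda>x. \<Sum>i\<in>I. p i x) = (\<lambda>x. \<Sum>i\<in>I. real (deg i) * p i x)"
proof
  fix x
  have "euler B (\<lambda>x. \<Sum>i\<in>I. p i x) x = (\<Sum>b\<in>B. \<Sum>i\<in>I. (x \<bullet> b) * partial_deriv b (p i) x)"
    using homogeneousD(1)[OF assms(2)] assms(1)
    by (simp add: euler_def partial_deriv_sum sum_distrib_left)
  also have "\<dots> = (\<Sum>i\<in>I. euler B (p i) x)"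
    by (subst sum.swap) (simp add: euler_def)
  finally show "euler B (\<lambda>x. \<Sum>i\<in>I. p i x) x = (\<Sum>i\<in>I. real (deg i) * p i x)"
    by (simp add: euler_homogeneous[OF onb assms(2)])
qed

context
  fixes Q :: "('a \<Rightarrow> real) set"
  assumes lapQ: "laplacian_algebra B Q"
begin

lemma lapalg_euler:
  assumes f: "f \<in> Q"
  shows "euler B f \<in> Q"
proof -
  let ?g = "\<lambda>x. laplacian B (\<lambda>x. radius_squared B x * f x) x
     - radius_squared B x * laplacian B f x - 2 * real (card B) * f x"
  have "?g \<in> Q"
    using f by (intro lapalg_diff[OF lapQ] lapalg_laplacian[OF lapQ] lapalg_mult[OF lapQ] lapalg_radius_squared[OF lapQ] lapalg_const[OF lapQ])
  moreover have "euler B f = (\<lambda>x. (1 / 4) * ?g x)"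
    by (simp add: laplacian_radius_squared_mult[OF onb lapalg_polynomial[OF lapQ f]])
  ultimately show ?thesis using lapalg_cmult[OF lapQ, of ?g "1 / 4"] by simp
qed

text \<open>
  The components are eigenvectors of the Euler operator with distinct eigenvalues: applying
  \<open>E - deg j\<close> removes the component \<open>j\<close> and rescales the others by nonzero factors.
\<close>

lemma lapalg_homogeneous_component:
  assumes "finite I" "inj_on deg I" "\<And>i. i \<in> I \<Longrightarrow> homogeneous (deg i) (p i)"
    and "(\<lambda>x. \<Sum>i\<in>I. p i x) \<in> Q" "k \<in> I"
  shows "p k \<in> Q"
  using assms
proof (induction I arbitrary: p k rule: finite_induct)
  case empty
  then show ?case by simp
next
  case (insert j I)
  let ?f = "\<lambda>x. \<Sum>i\<in>insert j I. p i x"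
  let ?q = "\<lambda>i x. (real (deg i) - real (deg j)) * p i x"
  have f: "?f \<in> Q" by (rule insert.prems(3))
  have "(\<lambda>x. euler B ?f x - real (deg j) * ?f x) \<in> Q"
    by (intro lapalg_diff[OF lapQ] lapalg_euler lapalg_cmult[OF lapQ] f)
  moreover have "euler B ?f = (\<lambda>x. \<Sum>i\<in>insert j I. real (deg i) * p i x)"
    by (rule euler_sum_homogeneous) (use insert.hyps insert.prems(2) in auto)
  then have "(\<lambda>x. euler B ?f x - real (deg j) * ?f x) = (\<lambda>x. \<Sum>i\<in>I. ?q i x)"
    using insert.hyps by (simp add: sum_distrib_left algebra_simps sum_subtractf)
  ultimately have q: "(\<lambda>x. \<Sum>i\<in>I. ?q i x) \<in> Q" by simp
  have rest: "p i \<in> Q" if "i \<in> I" for i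
  proof -
    have "?q i \<in> Q"
      by (rule insert.IH[OF _ _ q that])
        (use insert.prems(1,2) in \<open>auto intro: homogeneous_cmult\<close>)
    then have "(\<lambda>x. (1 / (real (deg i) - real (deg j))) * ?q i x) \<in> Q" by (rule lapalg_cmult[OF lapQ])
    moreover have "deg i \<noteq> deg j" using that insert.hyps insert.prems(1) by (auto simp: inj_on_def)
    ultimately show ?thesis by simp
  qed
  show ?case
  proof (cases "k = j")
    case True
    have "(\<lambda>x. ?f x - (\<Sum>i\<in>I. p i x)) \<in> Q"
      using rest insert.hyps by (intro lapalg_diff[OF lapQ] f lapalg_sum[OF lapQ]) auto
    then show ?thesis using True insert.hyps by simp
  next
    case False
    then show ?thesis using rest insert.prems(4) by simp
  qed
qed

text \<open>
  By induction \<open>\<Delta>f\<close>, of degree two less, is a sum of terms \<open>r\<^sup>2\<^sup>i h\<^sub>i\<close>.  Dividing each by the factor from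
  \<open>laplacian_radius_squared_power_mult\<close> gives \<open>G\<close>, divisible by \<open>r\<^sup>2\<close>, with \<open>\<Delta>G = \<Delta>f\<close>, and
  \<open>f - G\<close> is the harmonic term \<open>h 0\<close>.  The harmonic terms with \<open>2i > d\<close> are set to zero, where the truncated degree
  \<open>d - 2 * i\<close> has no meaning.
\<close>

lemma lapalg_harmonic_components:
  assumes "B \<noteq> {}" "f \<in> Q" "homogeneous d f"
  shows "\<exists>h. (\<forall>i. h i \<in> Q \<and> harmonic B (h i) \<and> homogeneous (d - 2 * i) (h i) \<and>
                (d < 2 * i \<longrightarrow> h i = (\<lambda>x. 0))) \<and>
             f = (\<lambda>x. \<Sum>i\<le>d. radius_squared B x ^ i * h i x)"
  using assms(2,3)
proof (induction d arbitrary: f rule: less_induct)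
  case (less d)
  let ?R = "radius_squared B"
  show ?case
  proof (cases "d < 2")
    case True
    then have "laplacian B f = (\<lambda>x. 0)" using less.prems laplacian_homogeneous_lt_2 by blast
    then have h: "harmonic B f" using less.prems by (simp add: harmonic_def homogeneousD)
    define h where "h i = (if i = 0 then f else (\<lambda>x. 0))" for i :: nat
    have "(\<Sum>i\<le>d. ?R x ^ i * h i x) = (\<Sum>i\<le>d. if i = 0 then f x else 0)" for x
      by (rule sum.cong) (auto simp: h_def)
    then have "f = (\<lambda>x. \<Sum>i\<le>d. ?R x ^ i * h i x)" by simp
    then show ?thesis using less.prems h
      by (intro exI[of _ h]) (auto simp: h_def homogeneous_zero harmonic_zero lapalg_const[OF lapQ])
  next
    case False
    define e where "e = d - 2"
    have d: "d = Suc (Suc e)" using False by (simp add: e_def)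
    have L: "laplacian B f \<in> Q" "homogeneous e (laplacian B f)"
      using less.prems lapalg_laplacian[OF lapQ] homogeneous_laplacian[OF finite_frame[OF onb]] e_def by auto
    from less.IH[OF _ L] d obtain h where
      h: "\<And>i. h i \<in> Q" "\<And>i. harmonic B (h i)" "\<And>i. homogeneous (e - 2 * i) (h i)"
         "\<And>i. e < 2 * i \<Longrightarrow> h i = (\<lambda>x. 0)"
      and Lf: "laplacian B f = (\<lambda>x. \<Sum>i\<le>e. ?R x ^ i * h i x)" by auto
    define c where "c i = 2 * (real i + 1) * (2 * real i + 2 * real (e - 2 * i) + real (card B))" for i
    have c: "c i > 0" for i
    proof -
      have "card B > 0" using assms(1) finite_frame[OF onb] by (simp add: card_gt_0_iff)
      then show ?thesis unfolding c_def by (intro mult_pos_pos add_nonneg_pos) auto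
    qed
    define g where "g i x = (1 / c i) * h i x" for i x
    have gQ: "g i \<in> Q" for i unfolding g_def[abs_def] by (intro lapalg_cmult[OF lapQ] h)
    have gh: "harmonic B (g i)" for i unfolding g_def[abs_def] by (intro harmonic_cmult h)
    have gd: "homogeneous (e - 2 * i) (g i)" for i
      unfolding g_def[abs_def] by (intro homogeneous_cmult h)
    have g0: "g i = (\<lambda>x. 0)" if "e < 2 * i" for i using h(4)[OF that] by (simp add: g_def[abs_def])
    have Lg: "laplacian B (\<lambda>x. ?R x ^ Suc i * g i x) = (\<lambda>x. ?R x ^ i * h i x)" for i
      unfolding laplacian_radius_squared_power_mult[OF onb gh gd] c_def[symmetric]
      using c[of i] by (simp add: g_def)
    define G where "G x = (\<Sum>i\<le>e. ?R x ^ Suc i * g i x)" for x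
    have tQ: "(\<lambda>x. ?R x ^ Suc i * g i x) \<in> Q" for i
      by (intro lapalg_mult[OF lapQ] lapalg_power[OF lapQ] lapalg_radius_squared[OF lapQ] gQ)
    have GQ: "G \<in> Q" unfolding G_def[abs_def] by (intro lapalg_sum[OF lapQ] tQ) auto
    have LG: "laplacian B G = laplacian B f"
      unfolding G_def[abs_def]
      by (subst laplacian_sum) (auto simp: lapalg_polynomial[OF lapQ tQ] Lg Lf simp del: power_Suc)
    have Gd: "homogeneous d G"
      unfolding G_def[abs_def]
    proof (rule homogeneous_sum)
      fix i assume "i \<in> {..e}"
      show "homogeneous d (\<lambda>x. ?R x ^ Suc i * g i x)"
      proof (cases "e < 2 * i")
        case True
        then show ?thesis by (simp add: g0 homogeneous_zero)
      next
        case False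
        then have "2 * Suc i + (e - 2 * i) = d" using d by simp
        then show ?thesis using homogeneous_mult[OF homogeneous_radius_squared_power[OF onb, of "Suc i"] gd[of i]] by simp
      qed
    qed simp
    define f0 where "f0 x = f x - G x" for x
    have f0_eq: "f0 = (\<lambda>x. f x + (- 1) * G x)" by (simp add: f0_def[abs_def])
    have f0Q: "f0 \<in> Q" unfolding f0_def[abs_def] by (intro lapalg_diff[OF lapQ] less.prems GQ)
    have f0d: "homogeneous d f0"
      unfolding f0_eq by (intro homogeneous_add homogeneous_cmult less.prems Gd)
    have f0h: "harmonic B f0"
      unfolding harmonic_def
    proof
      show "real_polynomial_function f0" by (rule homogeneousD(1)[OF f0d])
      have "real_polynomial_function (\<lambda>x. (- 1) * G x)"
        by (rule homogeneousD(1)[OF homogeneous_cmult[OF Gd]])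
      then show "laplacian B f0 = (\<lambda>x. 0)"
        unfolding f0_eq laplacian_add[OF homogeneousD(1)[OF less.prems(2)]]
          laplacian_cmult[OF homogeneousD(1)[OF Gd]] LG
        using laplacian_add[OF homogeneousD(1)[OF less.prems(2)], of "\<lambda>x. (- 1) * G x" B]
          laplacian_cmult[OF homogeneousD(1)[OF Gd], of B "- 1"] LG by simp
    qed
    define h' where "h' i = (case i of 0 \<Rightarrow> f0 | Suc j \<Rightarrow> g j)" for i
    have "f x = (\<Sum>i\<le>d. ?R x ^ i * h' i x)" for x
    proof -
      have "(\<Sum>i\<le>d. ?R x ^ i * h' i x) = f0 x + (\<Sum>i\<le>Suc e. ?R x ^ Suc i * g i x)"
        unfolding d by (subst sum.atMost_Suc_shift) (simp add: h'_def)
      also have "\<dots> = f0 x + G x" by (simp add: g0 G_def)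
      finally show ?thesis by (simp add: f0_def)
    qed
    moreover have "h' i \<in> Q \<and> harmonic B (h' i) \<and> homogeneous (d - 2 * i) (h' i) \<and>
        (d < 2 * i \<longrightarrow> h' i = (\<lambda>x. 0))" for i
      using f0Q f0h f0d gQ gh gd g0 by (cases i) (auto simp: h'_def d)
    ultimately show ?thesis by (intro exI[of _ h']) auto
  qed
qed

end

end

section \<open>Maximum principle and derivative bounds for harmonic polynomials\<close>

text \<open>
  Serves to make closed balls compact in an inner product space that is only known to have a
  finite orthonormal basis.
\<close>

lemma compact_box_span:
  fixes F :: "'a::real_normed_vector set"
  assumes "finite F"
  shows "compact {x. \<exists>c. (\<forall>b\<in>F. \<bar>c b\<bar> \<le> R) \<and> x = (\<Sum>b\<in>F. c b *\<^sub>R b)}"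
  using assms
proof (induction F rule: finite_induct)
  case empty
  then show ?case by simp
next
  case (insert b F)
  let ?K = "\<lambda>F. {x. \<exists>c. (\<forall>b\<in>F. \<bar>c b\<bar> \<le> R) \<and> x = (\<Sum>b\<in>F. c b *\<^sub>R b)}"
  have "compact ((\<lambda>t. t *\<^sub>R b) ` {-R..R})"
    by (intro compact_continuous_image continuous_intros compact_Icc)
  from compact_sums[OF this insert.IH]
  have "compact {x + y |x y. x \<in> (\<lambda>t. t *\<^sub>R b) ` {-R..R} \<and> y \<in> ?K F}" .
  moreover have "?K (insert b F) = {x + y |x y. x \<in> (\<lambda>t. t *\<^sub>R b) ` {-R..R} \<and> y \<in> ?K F}"
  proof (intro set_eqI iffI)
    fix z assume "z \<in> ?K (insert b F)"
    then obtain c where c: "\<forall>d\<in>insert b F. \<bar>c d\<bar> \<le> R" "z = (\<Sum>d\<in>insert b F. c d *\<^sub>R d)" by blast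
    then have z: "z = c b *\<^sub>R b + (\<Sum>d\<in>F. c d *\<^sub>R d)" using insert.hyps by simp
    have "c b \<in> {-R..R}" using c(1) by (auto simp: abs_le_iff)
    then show "z \<in> {x + y |x y. x \<in> (\<lambda>t. t *\<^sub>R b) ` {-R..R} \<and> y \<in> ?K F}"
      using z c(1) by blast
  next
    fix z assume "z \<in> {x + y |x y. x \<in> (\<lambda>t. t *\<^sub>R b) ` {-R..R} \<and> y \<in> ?K F}"
    then obtain t c where t: "t \<in> {-R..R}" and c: "\<forall>d\<in>F. \<bar>c d\<bar> \<le> R"
      and z: "z = t *\<^sub>R b + (\<Sum>d\<in>F. c d *\<^sub>R d)" by blast
    have "(\<Sum>d\<in>F. (c(b := t)) d *\<^sub>R d) = (\<Sum>d\<in>F. c d *\<^sub>R d)"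
      using insert.hyps by (intro sum.cong) auto
    then have "z = (\<Sum>d\<in>insert b F. (c(b := t)) d *\<^sub>R d)" using insert.hyps z by simp
    moreover have "\<forall>d\<in>insert b F. \<bar>(c(b := t)) d\<bar> \<le> R" using t c by (auto simp: abs_le_iff)
    ultimately show "z \<in> ?K (insert b F)" by blast
  qed
  ultimately show ?case by simp
qed

text \<open>
  A positive second derivative would make the first one, which vanishes at the maximum, positive just to its
  right.
\<close>

lemma second_partial_deriv_nonpos_at_max:
  assumes f: "real_polynomial_function f" and d: "d > 0"
    and max: "\<And>t. \<bar>t\<bar> < d \<Longrightarrow> f (x + t *\<^sub>R b) \<le> f x"
  shows "partial_deriv b (partial_deriv b f) x \<le> 0"
proof (rule ccontr)
  assume "\<not> ?thesis"
  then have pos: "partial_deriv b (partial_deriv b f) x > 0" by simp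
  let ?g = "\<lambda>t. f (x + t *\<^sub>R b)" and ?g' = "\<lambda>t. partial_deriv b f (x + t *\<^sub>R b)"
  have g: "(?g has_real_derivative ?g' t) (at t)" for t by (rule has_partial_deriv[OF f])
  have "?g' 0 = 0"
    by (rule DERIV_local_max[OF g[of 0] d]) (use max in auto)
  moreover have "(?g' has_real_derivative partial_deriv b (partial_deriv b f) x) (at 0)"
    by (rule has_partial_deriv_0) (use f in blast)
  from DERIV_pos_inc_right[OF this pos] obtain e where
    e: "e > 0" "\<And>h. h > 0 \<Longrightarrow> h < e \<Longrightarrow> ?g' 0 < ?g' h" by auto
  define s where "s = min d e / 2"
  have s: "0 < s" "s < d" "s < e" using d e(1) by (auto simp: s_def)
  have "\<exists>z. 0 < z \<and> z < s \<and> ?g s - ?g 0 = (s - 0) * ?g' z"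
    by (rule MVT2[OF s(1)]) (rule g)
  then obtain z where z: "0 < z" "z < s" "?g s - ?g 0 = s * ?g' z" by auto
  have "?g' z > 0" using e(2)[of z] z s \<open>?g' 0 = 0\<close> by linarith
  then have "?g s > ?g 0" using z(3) s(1) by (metis diff_gt_0_iff_gt mult_pos_pos)
  then show False using max[of s] s by simp
qed

context
  fixes B :: "'a::real_inner set"
  assumes onb: "orthonormal_basis B"
begin

lemma compact_cball_frame: "compact (cball (0::'a) R)"
proof -
  let ?K = "{x. \<exists>c. (\<forall>b\<in>B. \<bar>c b\<bar> \<le> R) \<and> x = (\<Sum>b\<in>B. c b *\<^sub>R b)}"
  have "cball 0 R \<subseteq> ?K"
  proof
    fix x :: 'a assume x: "x \<in> cball 0 R"
    have "\<bar>x \<bullet> b\<bar> \<le> R" if "b \<in> B" for b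
      using Cauchy_Schwarz_ineq2[of x b] onb that x by (auto simp: orthonormal_basis_def)
    then show "x \<in> ?K"
      using frame_expansion[OF onb, of x] by (intro CollectI exI[of _ "\<lambda>b. x \<bullet> b"]) auto
  qed
  then have "cball (0::'a) R = cball 0 R \<inter> ?K" by blast
  also have "compact \<dots>"
    by (rule closed_Int_compact[OF closed_cball compact_box_span[OF finite_frame[OF onb]]])
  finally show ?thesis .
qed

lemma compact_sphere_frame: "compact (sphere (0::'a) R)"
proof -
  have "sphere (0::'a) R = sphere 0 R \<inter> cball 0 R" by auto
  moreover have "closed (sphere (0::'a) R)"
    unfolding sphere_def by (simp add: dist_norm closed_Collect_eq continuous_on_norm_id)
  ultimately show ?thesis using closed_Int_compact compact_cball_frame by metis
qed

text \<open>
  Adding a small multiple of \<open>r\<^sup>2\<close> makes the Laplacian strictly positive without moving the maximum to the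
  sphere; at an interior maximum all second partial derivatives would be nonpositive.
\<close>

lemma subharmonic_maximum_principle:
  assumes ne: "B \<noteq> {}" and u: "real_polynomial_function u"
    and sub: "\<And>x. norm x \<le> R \<Longrightarrow> laplacian B u x \<ge> 0"
    and bd: "\<And>x. norm x = R \<Longrightarrow> u x \<le> M"
    and x0: "norm x0 \<le> R"
  shows "u x0 \<le> M"
proof (rule ccontr)
  assume "\<not> ?thesis"
  then have gt: "u x0 - M > 0" by simp
  let ?q = "radius_squared B"
  \<comment> \<open>Small enough that \<open>e r\<^sup>2\<close> contributes less than \<open>u x0 - M\<close> on the ball.\<close>
  define e where "e = (u x0 - M) / (2 * (R\<^sup>2 + 1))"
  have den: "R\<^sup>2 + 1 > 0" by (simp add: add_nonneg_pos)
  have e: "e > 0" using gt den by (simp add: e_def)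
  have eR: "e * R\<^sup>2 < u x0 - M"
  proof -
    have "e * R\<^sup>2 \<le> e * (R\<^sup>2 + 1)" using e by simp
    also have "\<dots> = (u x0 - M) / 2" using den by (simp add: e_def field_simps)
    finally show ?thesis using gt by simp
  qed
  define v where "v x = u x + e * ?q x" for x
  have q: "real_polynomial_function ?q" by (rule real_polynomial_function_radius_squared[OF onb])
  have eq: "real_polynomial_function (\<lambda>x. e * ?q x)"
    using q by (intro real_polynomial_function.intros(4) real_polynomial_function.intros(2))
  have v: "real_polynomial_function v"
    unfolding v_def[abs_def] using u eq by (rule real_polynomial_function.intros(3))
  have qn: "?q x = (norm x)\<^sup>2" for x
    by (simp add: radius_squared_eq[OF onb] power2_norm_eq_inner)
  have "x0 \<in> cball 0 R" using x0 by simp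
  then have "cball (0::'a) R \<noteq> {}" by blast
  from continuous_attains_sup[OF compact_cball_frame this
      continuous_on_real_polynomial_function[OF v]]
  obtain x1 where x1: "norm x1 \<le> R" "\<And>y. norm y \<le> R \<Longrightarrow> v y \<le> v x1" by auto
  have "v x0 \<ge> u x0" using e qn[of x0] by (simp add: v_def)
  then have vx1: "v x1 \<ge> u x0" using x1(2)[OF x0] by simp
  have "norm x1 \<noteq> R"
  proof
    assume n: "norm x1 = R"
    then have "v x1 \<le> M + e * R\<^sup>2" using bd[OF n] qn[of x1] by (simp add: v_def)
    then show False using vx1 eR by simp
  qed
  then have d: "R - norm x1 > 0" using x1(1) by simp
  have "partial_deriv b (partial_deriv b v) x1 \<le> 0" if b: "b \<in> B" for b
  proof (rule second_partial_deriv_nonpos_at_max[OF v d])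
    fix t assume "\<bar>t\<bar> < R - norm x1"
    moreover have "norm b = 1" using b onb by (simp add: orthonormal_basis_def)
    ultimately have "norm (x1 + t *\<^sub>R b) \<le> R" using norm_triangle_ineq[of x1 "t *\<^sub>R b"] by simp
    then show "v (x1 + t *\<^sub>R b) \<le> v x1" by (rule x1(2))
  qed
  then have "laplacian B v x1 \<le> 0" by (simp add: laplacian_def sum_nonpos)
  moreover have "laplacian B v x1 = laplacian B u x1 + e * (2 * real (card B))"
    unfolding v_def[abs_def] laplacian_add[OF u eq] laplacian_cmult[OF q]
    by (simp add: laplacian_radius_squared[OF onb])
  moreover have "card B > 0" using ne finite_frame[OF onb] by (simp add: card_gt_0_iff)
  then have "e * (2 * real (card B)) > 0" using e by simp
  ultimately show False using sub[OF x1(1)] by simp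
qed

lemma harmonic_maximum_principle:
  assumes "B \<noteq> {}" and h: "harmonic B h"
    and bd: "\<And>x. norm x = R \<Longrightarrow> \<bar>h x\<bar> \<le> M" and "norm x \<le> R"
  shows "\<bar>h x\<bar> \<le> M"
proof -
  have "c * h x \<le> M" if "\<bar>c\<bar> = 1" for c
  proof (rule subharmonic_maximum_principle[OF assms(1) _ _ _ assms(4)])
    have ch: "harmonic B (\<lambda>x. c * h x)" by (rule harmonic_cmult[OF h])
    then show "real_polynomial_function (\<lambda>x. c * h x)" by (simp add: harmonic_def)
    show "laplacian B (\<lambda>x. c * h x) y \<ge> 0" for y using ch by (simp add: harmonic_def)
    show "c * h y \<le> M" if "norm y = R" for y
      using bd[OF that] \<open>\<bar>c\<bar> = 1\<close> abs_le_D1[of "c * h y" M] by (simp add: abs_mult)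
  qed
  from this[of 1] this[of "- 1"] show ?thesis by simp
qed

lemma laplacian_square:
  assumes "real_polynomial_function w"
  shows "laplacian B (\<lambda>x. (w x)\<^sup>2) x = 2 * w x * laplacian B w x + 2 * (\<Sum>c\<in>B. (partial_deriv c w x)\<^sup>2)"
  unfolding power2_eq_square laplacian_mult[OF assms assms] by simp

text \<open>
  For \<open>r = R\<^sup>2\<close> the factor \<open>r - radius_squared B x\<close> is a cut-off that vanishes on the sphere of radius
  \<open>R\<close>.  Completing the square leaves, inside that sphere, a negative part bounded by a multiple of \<open>g\<^sup>2\<close> alone; no
  derivative of \<open>g\<close> survives in it.
\<close>

lemma harmonic_cutoff_laplacian:
  fixes r :: real
  assumes g: "harmonic B g"
  defines "w \<equiv> \<lambda>x. (r - radius_squared B x) * g x"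
  shows "real_polynomial_function w"
    and "laplacian B (\<lambda>x. (w x)\<^sup>2) x =
      (\<Sum>c\<in>B. 2 * ((r - radius_squared B x) * partial_deriv c g x - 4 * (x \<bullet> c) * g x)\<^sup>2)
      - (24 * radius_squared B x + 4 * real (card B) * (r - radius_squared B x)) * (g x)\<^sup>2"
proof -
  let ?q = "radius_squared B" and ?n = "real (card B)"
  let ?eta = "\<lambda>x. r + (- 1) * ?q x"
  have pg: "real_polynomial_function g" and Lg: "laplacian B g = (\<lambda>x. 0)"
    using g by (auto simp: harmonic_def)
  have pq: "real_polynomial_function ?q" by (rule real_polynomial_function_radius_squared[OF onb])
  have pr: "real_polynomial_function (\<lambda>x. r)" by (rule real_polynomial_function.intros(2))
  have pmq: "real_polynomial_function (\<lambda>x. (- 1) * ?q x)"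
    by (rule real_polynomial_function.intros(4)[OF real_polynomial_function.intros(2) pq])
  have peta: "real_polynomial_function ?eta"
    using pr pmq by (rule real_polynomial_function.intros(3))
  have deta: "partial_deriv c ?eta = (\<lambda>x. - 2 * (x \<bullet> c))" for c
    unfolding partial_deriv_add[OF pr pmq] partial_deriv_cmult[OF pq]
    by (simp add: partial_deriv_radius_squared[OF onb])
  have "laplacian B (\<lambda>x. r) = (\<lambda>x. 0)" by (simp add: laplacian_eq)
  then have Leta: "laplacian B ?eta = (\<lambda>x. - 2 * ?n)"
    unfolding laplacian_add[OF pr pmq] laplacian_cmult[OF pq]
    by (simp add: laplacian_radius_squared[OF onb])
  have w: "w = (\<lambda>x. ?eta x * g x)" by (simp add: w_def)
  show pw: "real_polynomial_function w"
    unfolding w using peta pg by (rule real_polynomial_function.intros(4))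
  let ?e = "r - ?q x"
  have Lw: "laplacian B w x = - 2 * ?n * g x - (\<Sum>c\<in>B. 4 * (x \<bullet> c) * partial_deriv c g x)"
    unfolding w laplacian_mult[OF peta pg] Leta Lg deta
    by (simp add: sum_distrib_left sum_negf algebra_simps)
  have dw: "partial_deriv c w x = ?e * partial_deriv c g x - 2 * (x \<bullet> c) * g x" for c
    unfolding w partial_deriv_mult[OF peta pg] deta by (simp add: algebra_simps)
  have "laplacian B (\<lambda>x. (w x)\<^sup>2) x = 2 * w x * laplacian B w x + 2 * (\<Sum>c\<in>B. (partial_deriv c w x)\<^sup>2)"
    by (rule laplacian_square[OF pw])
  also have "\<dots> = 2 * (?e * g x) * (- 2 * ?n * g x - (\<Sum>c\<in>B. 4 * (x \<bullet> c) * partial_deriv c g x))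
      + 2 * (\<Sum>c\<in>B. (?e * partial_deriv c g x - 2 * (x \<bullet> c) * g x)\<^sup>2)"
    unfolding Lw dw by (simp add: w_def)
  also have "\<dots> = (\<Sum>c\<in>B. 2 * (?e * partial_deriv c g x - 2 * (x \<bullet> c) * g x)\<^sup>2
        - 2 * ?e * g x * (4 * (x \<bullet> c) * partial_deriv c g x)) - 4 * ?n * ?e * (g x)\<^sup>2"
  proof -
    have "2 * (e * y) * (- 2 * n * y - sum t B) + 2 * sum s B =
        (\<Sum>c\<in>B. 2 * s c - 2 * e * y * t c) - 4 * n * e * y\<^sup>2"
      for e y n :: real and s t :: "'a \<Rightarrow> real"
      by (simp add: sum_subtractf sum_distrib_left[symmetric] sum_distrib_right[symmetric]
          algebra_simps power2_eq_square)
    then show ?thesis .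
  qed
  also have "(\<Sum>c\<in>B. 2 * (?e * partial_deriv c g x - 2 * (x \<bullet> c) * g x)\<^sup>2
        - 2 * ?e * g x * (4 * (x \<bullet> c) * partial_deriv c g x)) =
      (\<Sum>c\<in>B. 2 * (?e * partial_deriv c g x - 4 * (x \<bullet> c) * g x)\<^sup>2 - 24 * (g x)\<^sup>2 * (x \<bullet> c)\<^sup>2)"
    by (intro sum.cong refl) (simp add: power2_eq_square algebra_simps)
  also have "\<dots> = (\<Sum>c\<in>B. 2 * (?e * partial_deriv c g x - 4 * (x \<bullet> c) * g x)\<^sup>2) - 24 * (g x)\<^sup>2 * ?q x"
    by (simp add: sum_subtractf radius_squared_def sum_distrib_left)
  finally show "laplacian B (\<lambda>x. (w x)\<^sup>2) x =
      (\<Sum>c\<in>B. 2 * (?e * partial_deriv c g x - 4 * (x \<bullet> c) * g x)\<^sup>2)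
      - (24 * ?q x + 4 * ?n * ?e) * (g x)\<^sup>2"
    by (simp add: algebra_simps)
qed

text \<open>
  Bernstein's method.  With \<open>w = (R\<^sup>2 - r\<^sup>2) \<partial>\<^sub>b h\<close> the function \<open>w\<^sup>2 + C h\<^sup>2\<close> is subharmonic for
  \<open>C = (12 + 2n) R\<^sup>2\<close>, because \<open>\<Delta>(h\<^sup>2) = 2 |\<nabla>h|\<^sup>2\<close> compensates the negative part of \<open>\<Delta>(w\<^sup>2)\<close>.  As \<open>w\<close>
  vanishes on the sphere, the maximum principle bounds this function by \<open>C M\<^sup>2\<close>.
\<close>

lemma harmonic_gradient_estimate:
  assumes ne: "B \<noteq> {}" and h: "harmonic B h" and b: "b \<in> B"
    and bd: "\<And>x. norm x = R \<Longrightarrow> \<bar>h x\<bar> \<le> M" and x: "norm x \<le> R"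
  shows "((R\<^sup>2 - (norm x)\<^sup>2) * partial_deriv b h x)\<^sup>2 \<le> (12 + 2 * real (card B)) * R\<^sup>2 * M\<^sup>2"
proof -
  let ?q = "radius_squared B" and ?n = "real (card B)"
  define C where "C = (12 + 2 * ?n) * R\<^sup>2"
  have C: "C \<ge> 0" by (simp add: C_def)
  define g where "g = partial_deriv b h"
  have g: "harmonic B g" unfolding g_def by (rule harmonic_partial_deriv[OF finite_frame[OF onb] h])
  define w where "w = (\<lambda>x. (R\<^sup>2 - ?q x) * g x)"
  have qn: "?q x = (norm x)\<^sup>2" for x
    by (simp add: radius_squared_eq[OF onb] power2_norm_eq_inner)
  have ph: "real_polynomial_function h" and Lh: "laplacian B h = (\<lambda>x. 0)"
    using h by (auto simp: harmonic_def)
  have pw: "real_polynomial_function w" unfolding w_def by (rule harmonic_cutoff_laplacian(1)[OF g])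
  have pw2: "real_polynomial_function (\<lambda>x. (w x)\<^sup>2)" using pw by (rule real_polynomial_function_power)
  have ph2: "real_polynomial_function (\<lambda>x. (h x)\<^sup>2)" using ph by (rule real_polynomial_function_power)
  have pCh: "real_polynomial_function (\<lambda>x. C * (h x)\<^sup>2)"
    using ph2 by (intro real_polynomial_function.intros(4) real_polynomial_function.intros(2))
  have "(w x)\<^sup>2 + C * (h x)\<^sup>2 \<le> C * M\<^sup>2"
  proof (rule subharmonic_maximum_principle[OF ne _ _ _ x])
    show "real_polynomial_function (\<lambda>x. (w x)\<^sup>2 + C * (h x)\<^sup>2)"
      using pw2 pCh by (rule real_polynomial_function.intros(3))
    fix y :: 'a
    show "0 \<le> laplacian B (\<lambda>x. (w x)\<^sup>2 + C * (h x)\<^sup>2) y" if y: "norm y \<le> R"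
    proof -
      have q0: "0 \<le> ?q y" "?q y \<le> R\<^sup>2" using y by (auto simp: qn intro: power_mono)
      have "laplacian B (\<lambda>x. (w x)\<^sup>2) y \<ge> - ((24 * ?q y + 4 * ?n * (R\<^sup>2 - ?q y)) * (g y)\<^sup>2)"
        unfolding w_def harmonic_cutoff_laplacian(2)[OF g] by (simp add: sum_nonneg)
      moreover have "(24 * ?q y + 4 * ?n * (R\<^sup>2 - ?q y)) * (g y)\<^sup>2 \<le> 2 * C * (g y)\<^sup>2"
      proof (rule mult_right_mono)
        have "4 * ?n * (R\<^sup>2 - ?q y) \<le> 4 * ?n * R\<^sup>2" using q0 by (intro mult_left_mono) auto
        moreover have "2 * C = 24 * R\<^sup>2 + 4 * ?n * R\<^sup>2" by (simp add: C_def algebra_simps)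
        ultimately show "24 * ?q y + 4 * ?n * (R\<^sup>2 - ?q y) \<le> 2 * C" using q0 by linarith
      qed simp
      moreover have "(g y)\<^sup>2 \<le> (\<Sum>c\<in>B. (partial_deriv c h y)\<^sup>2)"
        unfolding g_def using member_le_sum[OF b, of "\<lambda>c. (partial_deriv c h y)\<^sup>2"] finite_frame[OF onb]
        by simp
      then have "2 * C * (g y)\<^sup>2 \<le> 2 * C * (\<Sum>c\<in>B. (partial_deriv c h y)\<^sup>2)"
        using C by (intro mult_left_mono) auto
      moreover have "laplacian B (\<lambda>x. (w x)\<^sup>2 + C * (h x)\<^sup>2) y =
        laplacian B (\<lambda>x. (w x)\<^sup>2) y + 2 * C * (\<Sum>c\<in>B. (partial_deriv c h y)\<^sup>2)"
        unfolding laplacian_add[OF pw2 pCh] laplacian_cmult[OF ph2] laplacian_square[OF ph] Lh by simp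
      ultimately show ?thesis by linarith
    qed
    show "(w y)\<^sup>2 + C * (h y)\<^sup>2 \<le> C * M\<^sup>2" if y: "norm y = R"
    proof -
      have "(h y)\<^sup>2 \<le> M\<^sup>2" using bd[OF y] by (simp add: abs_le_square_iff[symmetric])
      then have "C * (h y)\<^sup>2 \<le> C * M\<^sup>2" using C by (rule mult_left_mono)
      then show ?thesis using y by (simp add: w_def qn)
    qed
  qed
  moreover have "C * (h x)\<^sup>2 \<ge> 0" using C by simp
  ultimately have "(w x)\<^sup>2 \<le> C * M\<^sup>2" by linarith
  then show ?thesis by (simp add: w_def qn g_def C_def)
qed

text \<open>
  Each derivative is bounded on the sphere of half the radius by the gradient estimate and is harmonic
  again, so the radius is halved once per derivative.  The constant is the same for all harmonic
  polynomials, whatever their degree; for arbitrary polynomials this fails.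
\<close>

lemma harmonic_iterated_deriv_bound:
  assumes ne: "B \<noteq> {}" and I: "set I \<subseteq> B" and R: "R > 0"
  shows "\<exists>C\<ge>0. \<forall>h M. harmonic B h \<longrightarrow> (\<forall>x. norm x = R \<longrightarrow> \<bar>h x\<bar> \<le> M) \<longrightarrow>
           \<bar>iterated_deriv I h 0\<bar> \<le> C * M"
  using I R
proof (induction I arbitrary: R)
  case Nil
  have "\<bar>h 0\<bar> \<le> M" if "harmonic B h" "\<forall>x. norm x = R \<longrightarrow> \<bar>h x\<bar> \<le> M" for h M
    using harmonic_maximum_principle[OF ne that(1), of R M 0] that(2) Nil by auto
  then show ?case by (intro exI[of _ 1]) auto
next
  case (Cons b I)
  from Cons.IH[of "R / 2"] Cons.prems obtain C where C: "C \<ge> 0"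
    "\<And>h M. harmonic B h \<Longrightarrow> (\<And>x. norm x = R / 2 \<Longrightarrow> \<bar>h x\<bar> \<le> M) \<Longrightarrow> \<bar>iterated_deriv I h 0\<bar> \<le> C * M"
    by auto
  \<comment> \<open>At radius \<open>R / 2\<close> the cut-off equals \<open>3/4 R\<^sup>2\<close>.\<close>
  define K where "K = sqrt ((12 + 2 * real (card B)) * R\<^sup>2) / (3 / 4 * R\<^sup>2)"
  have K: "K \<ge> 0" by (simp add: K_def)
  have "\<bar>iterated_deriv (b # I) h 0\<bar> \<le> (C * K) * M"
    if h: "harmonic B h" and bd: "\<forall>x. norm x = R \<longrightarrow> \<bar>h x\<bar> \<le> M" for h M
  proof -
    have b: "b \<in> B" using Cons.prems by simp
    then have "norm b = 1" using onb by (simp add: orthonormal_basis_def)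
    then have "norm (R *\<^sub>R b) = R" using Cons.prems by simp
    then have M: "M \<ge> 0" using bd abs_ge_zero order_trans by blast
    have "\<bar>partial_deriv b h x\<bar> \<le> K * M" if x: "norm x = R / 2" for x
    proof -
      have "R\<^sup>2 - (norm x)\<^sup>2 = 3 / 4 * R\<^sup>2" unfolding x by (simp add: power2_eq_square)
      moreover have "norm x \<le> R" using x Cons.prems by simp
      ultimately have "(3 / 4 * R\<^sup>2 * partial_deriv b h x)\<^sup>2 \<le> (12 + 2 * real (card B)) * R\<^sup>2 * M\<^sup>2"
        using harmonic_gradient_estimate[OF ne h b, of R M x] bd by simp
      then have "\<bar>3 / 4 * R\<^sup>2 * partial_deriv b h x\<bar> \<le> sqrt ((12 + 2 * real (card B)) * R\<^sup>2 * M\<^sup>2)"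
        by (rule real_le_rsqrt[of "\<bar>_\<bar>", simplified])
      also have "\<dots> = sqrt ((12 + 2 * real (card B)) * R\<^sup>2) * M"
        using M by (simp add: real_sqrt_mult)
      finally have "(3 / 4 * R\<^sup>2) * \<bar>partial_deriv b h x\<bar> \<le> sqrt ((12 + 2 * real (card B)) * R\<^sup>2) * M"
        by (simp add: abs_mult)
      moreover have "3 / 4 * R\<^sup>2 > 0" using Cons.prems by simp
      ultimately show ?thesis by (simp add: K_def field_simps)
    qed
    from C(2)[OF harmonic_partial_deriv[OF finite_frame[OF onb] h] this]
    show ?thesis by (simp add: mult.assoc)
  qed
  moreover have "C * K \<ge> 0" using C(1) K by simp
  ultimately show ?case by blast
qed

end

section \<open>Maximality\<close>

context
  fixes B :: "'a::real_inner set"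
  assumes onb: "orthonormal_basis B"
begin

text \<open>
  Induction on the degree: the partial derivatives vanish, and Euler's identity recovers
  \<open>k p\<close> from them.
\<close>

lemma homogeneous_eq_0:
  assumes "homogeneous k p" "\<And>I. set I \<subseteq> B \<Longrightarrow> length I = k \<Longrightarrow> iterated_deriv I p 0 = 0"
  shows "p = (\<lambda>x. 0)"
  using assms
proof (induction k arbitrary: p)
  case 0
  then have "p 0 = 0" using "0.prems"(2)[of "[]"] by simp
  then show ?case using homogeneous_0_eq[OF "0.prems"(1)] by auto
next
  case (Suc k)
  have "partial_deriv b p = (\<lambda>x. 0)" if b: "b \<in> B" for b
  proof (rule Suc.IH)
    show "homogeneous k (partial_deriv b p)" by (rule homogeneous_partial_deriv[OF Suc.prems(1)])
    show "iterated_deriv I (partial_deriv b p) 0 = 0" if "set I \<subseteq> B" "length I = k" for I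
      using Suc.prems(2)[of "b # I"] that b by simp
  qed
  then have "euler B p = (\<lambda>x. 0)" by (simp add: euler_def fun_eq_iff)
  then have "real (Suc k) * p x = 0" for x
    using euler_homogeneous[OF onb Suc.prems(1)] by metis
  then show ?case by (simp add: fun_eq_iff)
qed

text \<open>
  At \<open>0\<close> a derivative of order \<open>k\<close> sees only the component of degree \<open>k\<close>.
\<close>

lemma homogeneous_component_determined:
  assumes p: "homogeneous_expansion f m p" and q: "homogeneous_expansion g n q"
    and eq: "\<And>I. set I \<subseteq> B \<Longrightarrow> length I = k \<Longrightarrow> iterated_deriv I f 0 = iterated_deriv I g 0"
  shows "p k = q k"
proof -
  have *: "iterated_deriv I f 0 = iterated_deriv I (p k) 0"
    if p: "homogeneous_expansion f m p" and I: "length I = k" for I m p and f :: "'a \<Rightarrow> real"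
  proof -
    note h = homogeneous_expansionD(1)[OF p]
    have "f = (\<lambda>x. \<Sum>j\<le>max m k. p j x)" by (rule homogeneous_expansionD(2)[OF p]) simp
    then have "iterated_deriv I f 0 = (\<Sum>j\<le>max m k. iterated_deriv I (p j) 0)"
      using iterated_deriv_sum[of "{..max m k}" p I] homogeneousD(1)[OF h] by simp
    also have "\<dots> = (\<Sum>j\<le>max m k. if j = k then iterated_deriv I (p k) 0 else 0)"
      using iterated_deriv_homogeneous_0[OF h] I by (intro sum.cong) auto
    finally show ?thesis by simp
  qed
  have hp: "homogeneous k (p k)" and hq: "homogeneous k (q k)"
    by (rule homogeneous_expansionD(1)[OF p], rule homogeneous_expansionD(1)[OF q])
  have "(\<lambda>x. p k x + (- 1) * q k x) = (\<lambda>x. 0)"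
  proof (rule homogeneous_eq_0)
    show "homogeneous k (\<lambda>x. p k x + (- 1) * q k x)"
      by (intro homogeneous_add homogeneous_cmult hp hq)
    fix I assume I: "set I \<subseteq> B" "length I = k"
    show "iterated_deriv I (\<lambda>x. p k x + (- 1) * q k x) 0 = 0"
      using *[OF p I(2)] *[OF q I(2)] eq[OF I]
      by (simp only: iterated_deriv_linear[OF homogeneousD(1)[OF hp] homogeneousD(1)[OF hq]])
  qed
  then have "p k x + (- 1) * q k x = 0" for x by (rule fun_cong)
  then show ?thesis by (simp add: fun_eq_iff)
qed

lemma laplacian_algebra_polynomials: "laplacian_algebra B {f. real_polynomial_function f}"
  unfolding laplacian_algebra_def polynomial_subalgebra_def
  using real_polynomial_function_radius_squared[OF onb]
  by (auto simp: real_polynomial_function.intros(2-4) finite_frame[OF onb])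

lemma lapalg_expansion_mem:
  assumes A: "laplacian_algebra B A" and f: "f \<in> A" and p: "homogeneous_expansion f m p"
  shows "p k \<in> A"
proof (rule lapalg_homogeneous_component[OF onb A, where I = "{..max m k}" and deg = "\<lambda>k. k"])
  have "f = (\<lambda>x. \<Sum>j\<le>max m k. p j x)" by (rule homogeneous_expansionD(2)[OF p]) simp
  then show "(\<lambda>x. \<Sum>j\<le>max m k. p j x) \<in> A" using f by simp
qed (use homogeneous_expansionD(1)[OF p] in auto)

text \<open>
  In the expansion of each homogeneous component the powers of \<open>r\<^sup>2\<close> become \<open>1\<close> on the sphere.
\<close>

lemma lapalg_harmonic_representative:
  assumes ne: "B \<noteq> {}" and A: "laplacian_algebra B A" and f: "f \<in> A"
  shows "\<exists>h\<in>A. harmonic B h \<and> (\<forall>x. norm x = 1 \<longrightarrow> h x = f x)"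
proof -
  let ?q = "radius_squared B"
  obtain m p where p: "homogeneous_expansion f m p"
    using ex_homogeneous_expansion[OF lapalg_polynomial[OF A f]] by blast
  have "\<exists>h\<in>A. harmonic B h \<and> (\<forall>x. norm x = 1 \<longrightarrow> h x = p k x)" for k
  proof -
    have "p k \<in> A" "homogeneous k (p k)"
      by (rule lapalg_expansion_mem[OF A f p], rule homogeneous_expansionD(1)[OF p])
    from lapalg_harmonic_components[OF onb A ne this] obtain h where
      h: "\<And>i. h i \<in> A" "\<And>i. harmonic B (h i)" and pk: "p k = (\<lambda>x. \<Sum>i\<le>k. ?q x ^ i * h i x)"
      by blast
    have "?q x = 1" if "norm x = 1" for x
      using that by (simp add: radius_squared_eq[OF onb] norm_eq_1)
    then have "(\<Sum>i\<le>k. h i x) = p k x" if "norm x = 1" for x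
      using that by (simp add: pk)
    moreover have "(\<lambda>x. \<Sum>i\<le>k. h i x) \<in> A" by (intro lapalg_sum[OF A] h) simp
    moreover have "harmonic B (\<lambda>x. \<Sum>i\<le>k. h i x)" by (intro harmonic_sum h) simp
    ultimately show ?thesis by (intro bexI[of _ "\<lambda>x. \<Sum>i\<le>k. h i x"]) auto
  qed
  then obtain h where h: "\<And>k. h k \<in> A" "\<And>k. harmonic B (h k)"
    "\<And>k x. norm x = 1 \<Longrightarrow> h k x = p k x" by metis
  have "f = (\<lambda>x. \<Sum>k\<le>m. p k x)" by (rule homogeneous_expansionD(2)[OF p]) simp
  then have "(\<Sum>k\<le>m. h k x) = f x" if "norm x = 1" for x using h(3)[OF that] by simp
  moreover have "(\<lambda>x. \<Sum>k\<le>m. h k x) \<in> A" by (intro lapalg_sum[OF A] h) simp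
  moreover have "harmonic B (\<lambda>x. \<Sum>k\<le>m. h k x)" by (intro harmonic_sum h) simp
  ultimately show ?thesis by (intro bexI[of _ "\<lambda>x. \<Sum>k\<le>m. h k x"]) auto
qed

text \<open>
  The difference of \<open>F\<close> and a harmonic representative of an approximant is harmonic and small on
  the sphere, hence has small derivatives at \<open>0\<close>; only finitely many of them are prescribed, so
  they are attained and not merely approximated.
\<close>

lemma lapalg_harmonic_approximation_jet:
  assumes ne: "B \<noteq> {}" and A: "laplacian_algebra B A" and F: "harmonic B F"
    and appr: "\<And>e. e > 0 \<Longrightarrow> \<exists>a\<in>A. \<forall>x. norm x = 1 \<longrightarrow> \<bar>F x - a x\<bar> < e"
  shows "\<exists>a\<in>A. \<forall>I. set I \<subseteq> B \<and> length I \<le> d \<longrightarrow> iterated_deriv I a 0 = iterated_deriv I F 0"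
proof -
  define L where "L = {I. set I \<subseteq> B \<and> length I \<le> d}"
  have finL: "finite L" unfolding L_def by (rule finite_lists_length_le[OF finite_frame[OF onb]])
  have "\<exists>C\<ge>0. \<forall>h M. harmonic B h \<longrightarrow> (\<forall>x. norm x = 1 \<longrightarrow> \<bar>h x\<bar> \<le> M) \<longrightarrow>
           \<bar>iterated_deriv I h 0\<bar> \<le> C * M" if "I \<in> L" for I
    using harmonic_iterated_deriv_bound[OF onb ne, of I 1] that by (simp add: L_def)
  then obtain C where C: "\<And>I. I \<in> L \<Longrightarrow> C I \<ge> 0"
    "\<And>I h M. I \<in> L \<Longrightarrow> harmonic B h \<Longrightarrow> (\<forall>x. norm x = 1 \<longrightarrow> \<bar>h x\<bar> \<le> M) \<Longrightarrow>
       \<bar>iterated_deriv I h 0\<bar> \<le> C I * M" by metis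
  define D where "D = 1 + sum C L"
  have D: "D > 0" using C(1) by (simp add: D_def sum_nonneg add_pos_nonneg)
  have CD: "C I < D" if "I \<in> L" for I
    using member_le_sum[OF that, of C] C(1) finL by (simp add: D_def)
  let ?P = "{f. real_polynomial_function f}" and ?U = "{a \<in> A. harmonic B a}"
  have "\<exists>a\<in>?U. \<forall>I\<in>L. iterated_deriv I a 0 = iterated_deriv I F 0"
  proof (rule attained_if_approximable[OF finL, where P = ?P])
    show "(\<lambda>_. 0) \<in> ?U" using lapalg_const[OF A] harmonic_zero by auto
    show "?U \<subseteq> ?P" "F \<in> ?P" using F by (auto simp: harmonic_def)
    show "(\<lambda>x. g x + c * h x) \<in> ?P" if "g \<in> ?P" "h \<in> ?P" for c g h
      using that by (auto intro!: real_polynomial_function.intros(2-4))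
    show "(\<lambda>x. g x + c * h x) \<in> ?U" if "g \<in> ?U" "h \<in> ?U" for c g h
      using that by (auto intro: lapalg_add[OF A] lapalg_cmult[OF A] harmonic_add harmonic_cmult)
    show "iterated_deriv I (\<lambda>x. g x + c * h x) 0 = iterated_deriv I g 0 + c * iterated_deriv I h 0"
      if "g \<in> ?P" "h \<in> ?P" for I c g h
      using that by (simp add: iterated_deriv_linear)
    fix e :: real assume e: "e > 0"
    then obtain a where a: "a \<in> A" "\<forall>x. norm x = 1 \<longrightarrow> \<bar>F x - a x\<bar> < e / D"
      using appr[of "e / D"] D by auto
    obtain h where h: "h \<in> A" "harmonic B h" "\<forall>x. norm x = 1 \<longrightarrow> h x = a x"
      using lapalg_harmonic_representative[OF ne A a(1)] by blast
    have ph: "real_polynomial_function h" and pF: "real_polynomial_function F"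
      using h(2) F by (auto simp: harmonic_def)
    have "\<bar>iterated_deriv I h 0 - iterated_deriv I F 0\<bar> < e" if I: "I \<in> L" for I
    proof -
      have "harmonic B (\<lambda>x. h x + (- 1) * F x)" by (intro harmonic_add harmonic_cmult h F)
      moreover have "\<forall>x. norm x = 1 \<longrightarrow> \<bar>h x + (- 1) * F x\<bar> \<le> e / D"
        using a(2) h(3) by (force simp: abs_minus_commute)
      ultimately have "\<bar>iterated_deriv I (\<lambda>x. h x + (- 1) * F x) 0\<bar> \<le> C I * (e / D)"
        by (rule C(2)[OF I])
      also have "\<dots> < D * (e / D)" using CD[OF I] e D by (intro mult_strict_right_mono) auto
      finally show ?thesis using D by (simp only: iterated_deriv_linear[OF ph pF]) simp
    qed
    then show "\<exists>a\<in>?U. \<forall>I\<in>L. \<bar>iterated_deriv I a 0 - iterated_deriv I F 0\<bar> < e"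
      using h by blast
  qed
  then show ?thesis by (auto simp: L_def)
qed

text \<open>
  The core of the argument, for one homogeneous polynomial.  Passing from \<open>f\<close> to the harmonic
  \<open>F\<close> with the same values on the sphere loses nothing, because the summands of \<open>F\<close> have
  distinct degrees and can be separated again.
\<close>

lemma homogeneous_invariant_mem:
  assumes ne: "B \<noteq> {}" and A: "laplacian_algebra B A" and f: "homogeneous d f"
    and inv: "\<And>v w. (\<And>g. g \<in> A \<Longrightarrow> g v = g w) \<Longrightarrow> f v = f w"
  shows "f \<in> A"
proof -
  let ?q = "radius_squared B"
  have pf: "real_polynomial_function f" using f by (simp add: homogeneous_def)
  from lapalg_harmonic_components[OF onb laplacian_algebra_polynomials ne _ f] pf obtain h where
    h: "\<And>i. harmonic B (h i)" "\<And>i. homogeneous (d - 2 * i) (h i)"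
       "\<And>i. d < 2 * i \<Longrightarrow> h i = (\<lambda>x. 0)"
    and fh: "f = (\<lambda>x. \<Sum>i\<le>d. ?q x ^ i * h i x)" by auto
  define F where "F = (\<lambda>x. \<Sum>i\<le>d. h i x)"
  have F: "harmonic B F" unfolding F_def by (intro harmonic_sum h) simp
  have fF: "f x = F x" if "norm x = 1" for x
    using that by (simp add: fh F_def radius_squared_eq[OF onb] norm_eq_1)
  have "\<exists>a\<in>A. \<forall>x. norm x = 1 \<longrightarrow> \<bar>F x - a x\<bar> < e" if e: "e > 0" for e
  proof -
    obtain a where a: "a \<in> A" "\<And>x. x \<in> sphere 0 1 \<Longrightarrow> \<bar>f x - a x\<bar> < e"
    proof (rule Stone_Weierstrass_quotient[where S = "sphere 0 1" and A = A and f = f and e = e])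
      show "compact (sphere (0::'a) 1)" by (rule compact_sphere_frame[OF onb])
      show "continuous_on (sphere 0 1) g" if "g \<in> A" for g
        using continuous_on_real_polynomial_function lapalg_polynomial[OF A that] by blast
      show "continuous_on (sphere 0 1) f"
        using continuous_on_real_polynomial_function pf by blast
    qed (use e inv lapalg_const[OF A] lapalg_add[OF A] lapalg_mult[OF A] in blast)+
    then show ?thesis using fF by (intro bexI[of _ a]) auto
  qed
  from lapalg_harmonic_approximation_jet[OF ne A F this, of d] obtain a where
    a: "a \<in> A" "\<And>I. set I \<subseteq> B \<Longrightarrow> length I \<le> d \<Longrightarrow> iterated_deriv I a 0 = iterated_deriv I F 0"
    by blast
  obtain m p where p: "homogeneous_expansion a m p"
    using ex_homogeneous_expansion[OF lapalg_polynomial[OF A a(1)]] by blast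
  have "homogeneous_expansion (h i) d (\<lambda>j. if j = d - 2 * i then h i else (\<lambda>x. 0))" for i
    by (rule homogeneous_expansion_mono[OF homogeneous_expansion_homogeneous[OF h(2)]]) simp
  then obtain q where q: "homogeneous_expansion F d q"
    unfolding F_def using homogeneous_expansion_sum[of "{..d}" h d] by blast
  have "q k \<in> A" if "k \<le> d" for k
    using homogeneous_component_determined[OF p q, of k] a(2) that lapalg_expansion_mem[OF A a(1) p]
    by metis
  then have "(\<lambda>x. \<Sum>k\<le>d. q k x) \<in> A" by (intro lapalg_sum[OF A]) auto
  moreover have "F = (\<lambda>x. \<Sum>k\<le>d. q k x)" by (rule homogeneous_expansionD(2)[OF q]) simp
  ultimately have FA: "F \<in> A" by simp
  let ?I = "{i. 2 * i \<le> d}"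
  have finI: "finite ?I" by (rule finite_subset[of _ "{..d}"]) auto
  have FI: "F = (\<lambda>x. \<Sum>i\<in>?I. h i x)"
    unfolding F_def by (intro ext sum.mono_neutral_right) (auto simp: h(3) not_le)
  \<comment> \<open>\<open>d - 2 * i\<close> is injective only on the indices with \<open>2 * i \<le> d\<close>, hence the restriction to \<open>?I\<close>.\<close>
  have hA: "h i \<in> A" for i
  proof (cases "2 * i \<le> d")
    case True
    show ?thesis
    proof (rule lapalg_homogeneous_component[OF onb A finI, where deg = "\<lambda>i. d - 2 * i"])
      show "inj_on (\<lambda>i. d - 2 * i) ?I" by (auto simp: inj_on_def)
      show "(\<lambda>x. \<Sum>i\<in>?I. h i x) \<in> A" using FA FI by simp
    qed (use True h(2) in auto)
  next
    case False
    then show ?thesis using h(3)[of i] lapalg_const[OF A] by simp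
  qed
  show ?thesis
    unfolding fh
    by (intro lapalg_sum[OF A] lapalg_mult[OF A] lapalg_power[OF A]
        lapalg_radius_squared[OF A] hA) simp
qed

text \<open>
  Reduction to the homogeneous case.  The points \<open>t v\<close> and \<open>t w\<close> are equivalent whenever \<open>v\<close> and \<open>w\<close> are, so
  comparing coefficients in \<open>t\<close> shows that the components inherit the invariance of \<open>f\<close>.
  In dimension zero there is no sphere to work on, but every function is constant.
\<close>

lemma invariant_mem:
  assumes A: "laplacian_algebra B A" and f: "real_polynomial_function f"
    and inv: "\<And>v w. (\<And>g. g \<in> A \<Longrightarrow> g v = g w) \<Longrightarrow> f v = f w"
  shows "f \<in> A"
proof (cases "B = {}")
  case True
  then have "x = 0" for x :: 'a using frame_expansion[OF onb, of x] by simp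
  then have "f = (\<lambda>x. f 0)" by metis
  then show ?thesis using lapalg_const[OF A, of "f 0"] by simp
next
  case False
  obtain m p where p: "homogeneous_expansion f m p" using ex_homogeneous_expansion[OF f] by blast
  have h: "homogeneous k (p k)" for k by (rule homogeneous_expansionD(1)[OF p])
  have fp: "f = (\<lambda>x. \<Sum>k\<le>m. p k x)" by (rule homogeneous_expansionD(2)[OF p]) simp
  have "p k \<in> A" if k: "k \<le> m" for k
  proof (rule homogeneous_invariant_mem[OF False A h])
    fix v w assume vw: "\<And>g. g \<in> A \<Longrightarrow> g v = g w"
    have "f (t *\<^sub>R v) = f (t *\<^sub>R w)" for t
    proof (rule inv)
      fix g assume g: "g \<in> A"
      obtain n r where r: "homogeneous_expansion g n r"
        using ex_homogeneous_expansion[OF lapalg_polynomial[OF A g]] by blast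
      have "g x = (\<Sum>k\<le>n. r k x)" for x by (rule fun_cong[OF homogeneous_expansionD(2)[OF r]]) simp
      moreover have "r k (t *\<^sub>R x) = t ^ k * r k x" for k x
        by (rule homogeneousD(2)[OF homogeneous_expansionD(1)[OF r]])
      moreover have "r k v = r k w" for k by (rule vw[OF lapalg_expansion_mem[OF A g r]])
      ultimately show "g (t *\<^sub>R v) = g (t *\<^sub>R w)" by simp
    qed
    then have "\<forall>t. (\<Sum>k\<le>m. p k v * t ^ k) = (\<Sum>k\<le>m. p k w * t ^ k)"
      by (simp add: fp homogeneousD(2)[OF h] mult.commute)
    then show "p k v = p k w" using polyfun_eq_coeffs[of "\<lambda>k. p k v" m "\<lambda>k. p k w"] k by blast
  qed
  then show ?thesis unfolding fp by (intro lapalg_sum[OF A]) auto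
qed

end

theorem theorem1:
  fixes B :: "'a::real_inner set" and A :: "('a \<Rightarrow> real) set"
  assumes "orthonormal_basis B"
    and "laplacian_algebra B A"
  shows "maximal_subalgebra A"
  unfolding maximal_subalgebra_def
proof (intro set_eqI iffI)
  fix f assume f: "f \<in> A"
  have "f constant_on C" if C: "C \<in> UNIV // algebra_rel A" for C
  proof -
    from C obtain v where "C = algebra_rel A `` {v}" by (rule quotientE)
    then show ?thesis using f by (auto simp: constant_on_def algebra_rel_def intro!: exI[of _ "f v"])
  qed
  then show "f \<in> {f. real_polynomial_function f \<and> (\<forall>C\<in>UNIV // algebra_rel A. f constant_on C)}"
    using lapalg_polynomial[OF assms(2) f] by blast
next
  fix f assume "f \<in> {f. real_polynomial_function f \<and> (\<forall>C\<in>UNIV // algebra_rel A. f constant_on C)}"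
  then have f: "real_polynomial_function f"
    and const: "\<And>C. C \<in> UNIV // algebra_rel A \<Longrightarrow> f constant_on C" by auto
  show "f \<in> A"
  proof (rule invariant_mem[OF assms f])
    fix v w assume "\<And>g. g \<in> A \<Longrightarrow> g v = g w"
    then have "v \<in> algebra_rel A `` {v}" "w \<in> algebra_rel A `` {v}"
      by (auto simp: algebra_rel_def)
    moreover have "f constant_on algebra_rel A `` {v}" by (intro const quotientI) simp
    ultimately show "f v = f w" unfolding constant_on_def by metis
  qed
qed

end
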